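(* Let $K_{3,3}$ be the graph with vertex set $V=\{v_1,\dots,v_6\}$ and edge set $\{v_6v_1,v_1v_2,v_2v_3,v_3v_4,v_4v_5,v_5v_6,v_1v_4,v_2v_5,v_3v_6\}$. Let $G_3,G_2,G_1,G_0$ be the subgraphs with the same vertex set $V$ and edge sets $E_{G_3}=E_{K_{3,3}}\setminus\{v_2v_5\}$, $E_{G_2}=E_{G_3}\setminus\{v_3v_6\}$, $E_{G_1}=E_{G_2}\setminus\{v_1v_4\}$, $E_{G_0}=E_{G_1}\setminus\{v_5v_6\}$. Let $l_{G_0}:E_{G_0}\to\mathbb{R}^{\geq 0}$ be any length function on $G_0$. Then: (1) the set of values $f\in\mathbb{R}^{\geq 0}$ such that $(G_1,l_{G_1})$ is realizable, where $l_{G_1}$ is the extension of $l_{G_0}$ with $l_{G_1}(v_5v_6)=f$, is an interval; (2) for each $l_{G_1}$ extending $l_{G_0}$ such that $(G_1,l_{G_1})$ is realizable, the set of values $\alpha\in\mathbb{R}^{\geq 0}$ such that $(G_2,l_{G_2})$ is realizable, where $l_{G_2}$ is the extension of $l_{G_1}$ with $l_{G_2}(v_1v_4)=\alpha$, is an interval; (3) for each $l_{G_2}$ extending such an $l_{G_1}$ such that $(G_2,l_{G_2})$ is realizable, the set of values $\beta\in\mathbb{R}^{\geq 0}$ such that $(G_3,l_{G_3})$ is realizable, where $l_{G_3}$ is the extension of $l_{G_2}$ with $l_{G_3}(v_3v_6)=\beta$, is either an interval or the disjoint union of two intervals; (4) for each $l_{G_3}$ extending such an $l_{G_2}$ such that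 $(G_3,l_{G_3})$ is realizable, the set of values $\gamma\in\mathbb{R}^{\geq 0}$ such that $(K_{3,3},l)$ is realizable, where $l$ is the extension of $l_{G_3}$ with $l(v_2v_5)=\gamma$, is an interval or the disjoint union of two, three or four intervals.
   Context: A length function on a graph $G=(V_G,E_G)$ is a function $l:E_G\to\mathbb{R}^{\geq 0}$; a weighted graph is a pair $(G,l)$. A realization of $(G,l)$ is a map $p:V_G\to\mathbb{E}^2$ (the Euclidean plane, with Euclidean distance $d$) such that $d(p(u),p(v))=l(uv)$ for all $uv\in E_G$ (no injectivity is required). $(G,l)$ is realizable if it has at least one realization. Intervals may be degenerate, i.e. a single point counts as an interval. *)

theory Defs
  imports "HOL-Analysis.Analysis"
begin

text \<open>A simple graph is a pair (vertex set, edge set), the edge \<open>uv\<close> being the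
  unordered pair \<open>{u, v}\<close>.\<close>

type_synonym 'a graph = "'a set \<times> 'a set set"

abbreviation verts :: "'a graph \<Rightarrow> 'a set" where "verts G \<equiv> fst G"
abbreviation edges :: "'a graph \<Rightarrow> 'a set set" where "edges G \<equiv> snd G"

definition delete_edge :: "'a graph \<Rightarrow> 'a set \<Rightarrow> 'a graph" where
  "delete_edge G e = (verts G, edges G - {e})"

text \<open>Functions with domain exactly \<open>edges G\<close> are the extensional ones; hence, for
  an edge \<open>e\<close> of \<open>G\<close>, updating a length function of \<open>delete_edge G e\<close> at \<open>e\<close> with a
  nonnegative value gives a length function of \<open>G\<close>.\<close>

definition length_functions :: "'a graph \<Rightarrow> ('a set \<Rightarrow> real) set" where
  "length_functions G = edges G \<rightarrow>\<^sub>E {0..}"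

definition extensions :: "'a graph \<Rightarrow> 'a graph \<Rightarrow> ('a set \<Rightarrow> real) \<Rightarrow> ('a set \<Rightarrow> real) set" where
  "extensions H G l = {l' \<in> length_functions H. \<forall>e\<in>edges G. l' e = l e}"

text \<open>Values of \<open>p\<close> outside \<open>verts G\<close> are irrelevant.\<close>

definition is_realization :: "'a graph \<Rightarrow> ('a set \<Rightarrow> real) \<Rightarrow> ('a \<Rightarrow> real ^ 2) \<Rightarrow> bool" where
  "is_realization G l p \<longleftrightarrow>
     (\<forall>u\<in>verts G. \<forall>v\<in>verts G. {u, v} \<in> edges G \<longrightarrow> dist (p u) (p v) = l {u, v})"

definition realizable :: "'a graph \<Rightarrow> ('a set \<Rightarrow> real) \<Rightarrow> bool" where
  "realizable G l \<longleftrightarrow> (\<exists>p. is_realization G l p)"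

text \<open>\<open>is_interval\<close> allows the empty set, which is not counted as an interval here;
  otherwise it could be used to pad a disjoint union.\<close>

definition real_interval :: "real set \<Rightarrow> bool" where
  "real_interval I \<longleftrightarrow> is_interval I \<and> I \<noteq> {}"

definition disjoint_union_of_intervals :: "nat \<Rightarrow> real set \<Rightarrow> bool" where
  "disjoint_union_of_intervals k S \<longleftrightarrow>
     (\<exists>\<I>. finite \<I> \<and> card \<I> = k \<and> disjoint \<I> \<and> (\<forall>I\<in>\<I>. real_interval I) \<and> S = \<Union>\<I>)"

datatype vertex = v1 | v2 | v3 | v4 | v5 | v6

definition K33 :: "vertex graph" where
  "K33 = ({v1, v2, v3, v4, v5, v6},
          {{v6, v1}, {v1, v2}, {v2, v3}, {v3, v4}, {v4, v5}, {v5, v6},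
           {v1, v4}, {v2, v5}, {v3, v6}})"

definition G3 :: "vertex graph" where "G3 = delete_edge K33 {v2, v5}"
definition G2 :: "vertex graph" where "G2 = delete_edge G3 {v3, v6}"
definition G1 :: "vertex graph" where "G1 = delete_edge G2 {v1, v4}"
definition G0 :: "vertex graph" where "G0 = delete_edge G1 {v5, v6}"

end

theory Submission
  imports Defs
begin

text \<open>The first three parts hold because the configurations, up to symmetry, form one or two
  connected sets. For the last part, put \<open>x = d(v1, v3)\<close> and \<open>y = d(v4, v6)\<close>. The four-bar linkage
  \<open>v1 v4 v3 v6\<close> traces a closed curve in the \<open>(x, y)\<close>-plane, an upper arc (\<open>v4\<close>, \<open>v6\<close> on opposite
  sides of \<open>v1 v3\<close>) and a lower arc (same side). In squared lengths it bounds the convex set of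
  pairs realisable in higher dimension, hence each arc is unimodal. The triangles on \<open>v2\<close> and \<open>v5\<close>
  restrict \<open>(x, y)\<close> to a rectangle, and over each point of the curve there are two sides to choose
  for each of \<open>v2\<close> and \<open>v5\<close>. Cutting each arc at its extremum gives 16 connected pieces (upper or
  lower, left or right, two sides). At its outer end a piece meets the one with the other side of
  \<open>v2\<close> (if the triangle on \<open>v2\<close> degenerates there) or the one on the other arc; at its inner end
  it meets the one with the other side of \<open>v5\<close> or its left-right neighbour. Following these two
  gluings alternately never returns after fewer than four steps, so every component contains at
  least 4 of the 16 pieces.\<close>

section \<open>Counting components\<close>

text \<open>The bound 4 is 16 / 4, but two obstacles stand in the way of the count. A side of the
  rectangle with constant \<open>y\<close> may cut off an end of the curve: where the upper arc
  enters through the lower side, the lower arc is still outside, and instead of the two arcs it is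
  the two sides of \<open>v5\<close> that meet. By symmetry the same happens to the lower arc at the
  upper side. The absent piece of the other arc is then replaced by the end fibre of the arc that is
  present, so that both gluings remain defined on all 16 indices. The other obstacle is that
  \<open>x\<close> parametrises the linkage only while \<open>v1\<close> and \<open>v3\<close> are
  distinct. At \<open>x = 0\<close> the linkage still moves, and the positions of \<open>v2\<close>
  fill a circle. This requires the two sides at \<open>v4\<close>, the two at \<open>v6\<close> and
  the two at \<open>v2\<close> to be equal; the count is therefore made over an abstract parameter,
  which in that case is continued beyond \<open>x = 0\<close>. As the apex of a triangle cannot be
  chosen continuously there, pieces are shown connected through a projection with connected
  fibres.\<close>

lemma card_components_le:
  fixes S :: "'n::finite \<Rightarrow> 'a::topological_space set"
  assumes conn: "\<And>n. connected (S n)"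
    and X: "\<And>n. X (X n) = n" "\<And>n. X n \<noteq> n"
    and Y: "\<And>n. Y n \<noteq> n" "\<And>n. X n \<noteq> Y n"
    and SX: "\<And>n. S n \<noteq> {} \<Longrightarrow> S n \<inter> S (X n) \<noteq> {}"
    and SY: "\<And>n. S n \<noteq> {} \<Longrightarrow> S n \<inter> S (Y n) \<noteq> {}"
  shows "finite (components (\<Union>n. S n)) \<and> 4 * card (components (\<Union>n. S n)) \<le> CARD('n)"
proof -
  let ?U = "\<Union>n. S n"
  define f where "f K = {n. S n \<noteq> {} \<and> S n \<subseteq> K}" for K
  have step: "m \<in> f K" if "K \<in> components ?U" "n \<in> f K" "S n \<inter> S m \<noteq> {}" for K n m
  proof -
    have "K \<inter> S m \<noteq> {}"
      using that(2,3) by (auto simp: f_def)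
    then have "S m \<subseteq> K"
      using components_maximal[OF that(1) conn, of m] by blast
    then show ?thesis
      using that(3) by (auto simp: f_def)
  qed
  have ge4: "4 \<le> card (f K)" if K: "K \<in> components ?U" for K
  proof -
    obtain x where x: "x \<in> K"
      using in_components_nonempty[OF K] by blast
    then obtain n where n: "x \<in> S n"
      using in_components_subset[OF K] by blast
    then have "S n \<subseteq> K"
      using components_maximal[OF K conn, of n] x by blast
    then have n0: "n \<in> f K" using n by (auto simp: f_def)
    then have n1: "X n \<in> f K" and n2: "Y n \<in> f K"
      using step[OF K n0] SX[of n] SY[of n] by (auto simp: f_def)
    then have n3: "X (Y n) \<in> f K"
      using step[OF K n2] SX[of "Y n"] by (auto simp: f_def)
    \<comment> \<open>Applying the involution \<open>X\<close> turns \<open>X (Y n) = n\<close> into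
      \<open>Y n = X n\<close>, and \<open>X (Y n) = X n\<close> into \<open>Y n = n\<close>. The
      remaining coincidences are excluded directly. \<open>Y\<close> need not be an
      involution.\<close>
    have "distinct [n, X n, Y n, X (Y n)]"
      using X Y by (simp, metis)
    then have "card {n, X n, Y n, X (Y n)} = 4"
      using distinct_card[of "[n, X n, Y n, X (Y n)]"] by simp
    moreover have "{n, X n, Y n, X (Y n)} \<subseteq> f K"
      using n0 n1 n2 n3 by auto
    ultimately show ?thesis
      by (metis card_mono finite)
  qed
  have disj: "f K \<inter> f L = {}" if "K \<in> components ?U" "L \<in> components ?U" "K \<noteq> L" for K L
    using components_nonoverlap[OF that(1,2)] that(3) by (auto simp: f_def)
  have "inj_on f (components ?U)"
  proof (rule inj_onI)
    fix K L assume KL: "K \<in> components ?U" "L \<in> components ?U" "f K = f L"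
    have "f K \<noteq> {}" using ge4[OF KL(1)] by auto
    then show "K = L" using disj[OF KL(1,2)] KL(3) by blast
  qed
  then have fin: "finite (components ?U)"
    using finite_imageD finite by blast
  have "4 * card (components ?U) = (\<Sum>K\<in>components ?U. 4)"
    by simp
  also have "\<dots> \<le> (\<Sum>K\<in>components ?U. card (f K))"
    using ge4 by (intro sum_mono) auto
  also have "\<dots> = card (\<Union>K\<in>components ?U. f K)"
    using fin disj by (subst card_UN_disjoint) auto
  also have "\<dots> \<le> CARD('n)"
    by (intro card_mono) auto
  finally show ?thesis using fin by simp
qed

section \<open>From component counts to unions of intervals\<close>

lemma disjoint_union_of_components:
  fixes C :: "real set"
  assumes "finite (components C)"
  shows "disjoint_union_of_intervals (card (components C)) C"
proof -
  have "real_interval I" if "I \<in> components C" for I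
    using in_components_connected[OF that] in_components_nonempty[OF that]
    by (simp add: real_interval_def is_interval_connected_1)
  then show ?thesis
    unfolding disjoint_union_of_intervals_def using assms Union_components[of C]
    using pairwise_disjoint_components[of C]
    by (intro exI[of _ "components C"]) (auto simp: pairwise_def disjnt_def)
qed

lemma interval_or_few_intervals:
  fixes C :: "real set"
  assumes "C \<noteq> {}" "finite (components C)" "card (components C) \<le> 4"
  shows "real_interval C \<or> (\<exists>k\<in>{2, 3, 4}. disjoint_union_of_intervals k C)"
proof -
  have "card (components C) \<noteq> 0"
    using assms(1,2) by (simp add: components_eq_empty)
  then consider "card (components C) = 1" | "card (components C) \<in> {2, 3, 4}"
    using assms(3) by force
  then show ?thesis
  proof cases
    case 1
    then obtain K where "components C = {K}"
      by (auto simp: card_1_singleton_iff)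
    then have "C \<in> components C"
      using Union_components[of C] by auto
    then have "connected C" by (rule in_components_connected)
    then show ?thesis
      using assms(1) by (simp add: real_interval_def is_interval_connected_1)
  next
    case 2
    then show ?thesis
      using disjoint_union_of_components[OF assms(2)] by blast
  qed
qed

text \<open>If the two sets overlap or one is empty, their union is connected; otherwise they
  already form the partition.\<close>

lemma interval_or_two_intervals:
  fixes S T :: "real set"
  assumes "connected S" "connected T" "S \<union> T \<noteq> {}"
  shows "real_interval (S \<union> T) \<or> disjoint_union_of_intervals 2 (S \<union> T)"
proof (cases "S \<inter> T = {} \<and> S \<noteq> {} \<and> T \<noteq> {}")
  case True
  then have "disjoint_union_of_intervals 2 (S \<union> T)"
    unfolding disjoint_union_of_intervals_def using assms
    by (intro exI[of _ "{S, T}"])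
      (auto simp: disjoint_def real_interval_def is_interval_connected_1 card_insert_if)
  then show ?thesis ..
next
  case False
  then have "connected (S \<union> T)"
    using assms by (cases "S = {} \<or> T = {}") (auto intro: connected_Un)
  then show ?thesis
    using assms(3) by (simp add: real_interval_def is_interval_connected_1)
qed

text \<open>\<open>g u\<close> measures how far arc \<open>u\<close> of the curve is inside the rectangle, \<open>s\<close> and \<open>t\<close> are the sides of
  \<open>v2\<close> and \<open>v5\<close>, and \<open>\<Phi> u s t z\<close> is the set of spans over the point \<open>z\<close> of arc \<open>u\<close>.\<close>

lemma card_components_two_valleys:
  fixes g :: "bool \<Rightarrow> real \<Rightarrow> real" and \<Phi> :: "bool \<Rightarrow> bool \<Rightarrow> bool \<Rightarrow> real \<Rightarrow> 'a::topological_space set"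
  assumes "a \<le> b"
    and cont: "\<And>u. continuous_on {a..b} (g u)"
    and m: "\<And>u. m u \<in> {a..b}"
    and anti: "\<And>u. antimono_on {a..m u} (g u)" and mono: "\<And>u. mono_on {m u..b} (g u)"
    and conn: "\<And>u s t J. connected J \<Longrightarrow> compact J \<Longrightarrow> J \<subseteq> {z \<in> {a..b}. 0 \<le> g u z} \<Longrightarrow>
      connected (\<Union>z\<in>J. \<Phi> u s t z)"
    and ne: "\<And>u s t z. z \<in> {a..b} \<Longrightarrow> 0 \<le> g u z \<Longrightarrow> \<Phi> u s t z \<noteq> {}"
    and fold: "\<And>u s t z. z \<in> {a..b} \<Longrightarrow> g u z = 0 \<Longrightarrow> \<Phi> u s (\<not> t) z = \<Phi> u s t z"
    and ends: "\<And>e. e \<in> {a, b} \<Longrightarrow>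
      (\<forall>u s t. \<Phi> u (\<not> s) t e = \<Phi> u s t e) \<or>
      ((\<forall>u. 0 \<le> g u e) \<and> ((\<forall>s t. \<Phi> True s t e = \<Phi> False s t e) \<or>
        (\<forall>s t. \<Phi> True s t e = \<Phi> False (\<not> s) (\<not> t) e))) \<or>
      (\<exists>u. 0 \<le> g u e \<and> g (\<not> u) e < 0 \<and> (\<forall>s t. \<Phi> u s (\<not> t) e = \<Phi> u s t e))"
  defines "C \<equiv> \<Union>u s t. \<Union>z\<in>{z \<in> {a..b}. 0 \<le> g u z}. \<Phi> u s t z"
  shows "finite (components C) \<and> card (components C) \<le> 4"
proof -
  define e where "e h = (if h then b else a)" for h
  define H where "H u h = (if h then {m u..b} else {a..m u})" for u h
  define Z where "Z u h = {z \<in> H u h. 0 \<le> g u z}" for u h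
  \<comment> \<open>At the end \<open>e h\<close>, \<open>P h\<close> says that the two sides of
    \<open>v2\<close> merge, \<open>Q h\<close> that the two arcs meet up to a reflection, which
    flips both sides. \<open>R u\<close> says that arc \<open>u\<close> leaves the rectangle around
    its bottom \<open>m u\<close>, so that its two halves are not joined there.\<close>
  define P where "P h \<longleftrightarrow> (\<forall>u s t. \<Phi> u (\<not> s) t (e h) = \<Phi> u s t (e h))" for h
  define Q where "Q h \<longleftrightarrow> (\<forall>u. 0 \<le> g u (e h)) \<and>
    (\<forall>s t. \<Phi> True s t (e h) = \<Phi> False (\<not> s) (\<not> t) (e h))" for h
  define R where "R u \<longleftrightarrow> g u (m u) < 0" for u
  \<comment> \<open>A half-arc outside the rectangle borrows the end of the other arc, which keeps the gluing \<open>X\<close>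
    at that end defined.\<close>
  define S where "S = (\<lambda>(u, h, s, t).
    if Z u h = {} \<and> \<not> P h \<and> 0 \<le> g (\<not> u) (e h) then \<Phi> (\<not> u) s t (e h)
    else (\<Union>z\<in>Z u h. \<Phi> u s t z))"
  \<comment> \<open>\<open>X\<close> glues at the outer end of a piece and changes \<open>s\<close>
    or \<open>u\<close>; \<open>Y\<close> glues at its inner end and changes only \<open>t\<close>
    or only \<open>h\<close>. Hence they never agree and have no fixed points.\<close>
  define X where "X = (\<lambda>(u, h, s, t). if P h then (u, h, \<not> s, t)
    else if Q h then (\<not> u, h, \<not> s, \<not> t) else (\<not> u, h, s, t))"
  define Y where "Y = (\<lambda>(u, h, s::bool, t). if R u then (u, h, s, \<not> t) else (u, \<not> h, s, t))"
  have e: "e h \<in> {a..b}" "e h \<in> H u h" "m u \<in> H u h" for h u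
    using m[of u] \<open>a \<le> b\<close> by (auto simp: e_def H_def)
  have H: "H u h \<subseteq> {a..b}" for u h
    using m[of u] by (auto simp: H_def)
  \<comment> \<open>A half-arc is deepest inside the rectangle at its outer end, so it either
    contains that end or is entirely outside.\<close>
  have ge: "g u z \<le> g u (e h)" if "z \<in> H u h" for z u h
    using that anti[of u] mono[of u] m[of u]
    by (auto simp: e_def H_def monotone_on_def split: if_splits)
  have le: "g u (m u) \<le> g u z" if "z \<in> {a..b}" for z u
    using that anti[of u] mono[of u] m[of u]
    by (cases "z \<le> m u") (auto simp: monotone_on_def)
  have Z_e: "e h \<in> Z u h" if "Z u h \<noteq> {}" for u h
    using that ge e(2) by (force simp: Z_def)
  have Z_m: "m u \<in> Z u h" if "\<not> R u" for u h
    using that e(3) by (auto simp: Z_def R_def)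
  have Z_sub: "Z u h \<subseteq> {z \<in> {a..b}. 0 \<le> g u z}" for u h
    using H[of u h] by (auto simp: Z_def)
  \<comment> \<open>By the intermediate value theorem, a half-arc that is inside at its outer end
    and outside at \<open>m u\<close> crosses the boundary. There the triangle on \<open>v5\<close>
    degenerates and \<open>t\<close> can be switched.\<close>
  have Z_0: "\<exists>z\<in>Z u h. g u z = 0" if "R u" "Z u h \<noteq> {}" for u h
  proof -
    have "continuous_on (H u h) (g u)"
      using cont H continuous_on_subset by blast
    moreover have "connected (H u h)"
      by (auto simp: H_def)
    ultimately have "connected (g u ` H u h)"
      by (rule connected_continuous_image)
    moreover have "g u (m u) \<in> g u ` H u h" "g u (e h) \<in> g u ` H u h"
      using e by auto
    moreover have "g u (m u) \<le> 0" "0 \<le> g u (e h)"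
      using that Z_e[of u h] by (auto simp: R_def Z_def)
    ultimately have "0 \<in> g u ` H u h"
      using connectedD_interval by blast
    then show ?thesis by (auto simp: Z_def)
  qed
  have Z_conn: "connected (Z u h)" for u h
  proof -
    have "is_interval (Z u h)"
    proof (cases h)
      case True
      then show ?thesis
        using mono[of u] by (force simp: is_interval_1 Z_def H_def monotone_on_def)
    next
      case False
      then show ?thesis
        using anti[of u] by (force simp: is_interval_1 Z_def H_def monotone_on_def)
    qed
    then show ?thesis by (simp add: is_interval_connected_1)
  qed
  have Z_comp: "compact (Z u h)" for u h
  proof -
    have "closed (H u h)" by (auto simp: H_def)
    moreover have "continuous_on (H u h) (g u)"
      using cont H continuous_on_subset by blast
    ultimately have "closed (H u h \<inter> g u -` {0..})"
      by (intro continuous_closed_preimage) auto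
    moreover have "H u h \<inter> g u -` {0..} = Z u h"
      by (auto simp: Z_def)
    moreover have "bounded (Z u h)"
      using Z_sub bounded_subset[OF bounded_closed_interval[of a b]] by blast
    ultimately show ?thesis by (simp add: compact_eq_bounded_closed)
  qed
  have single: "connected (\<Phi> u s t z)" if "z \<in> {a..b}" "0 \<le> g u z" for u s t z
    using conn[of "{z}" u s t] that by auto
  have ends': "P h \<or> (\<forall>u. 0 \<le> g u (e h)) \<and> ((\<forall>s t. \<Phi> True s t (e h) = \<Phi> False s t (e h)) \<or> Q h) \<or>
      (\<exists>u. 0 \<le> g u (e h) \<and> g (\<not> u) (e h) < 0 \<and> (\<forall>s t. \<Phi> u s (\<not> t) (e h) = \<Phi> u s t (e h)))" for h
    using ends[of "e h"] unfolding P_def Q_def by (auto simp: e_def)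
  have mem: "\<Phi> u s t z \<subseteq> S (u, h, s, t)" if "z \<in> Z u h" for u h s t z
    using that by (auto simp: S_def)
  have virt: "S (u, h, s, t) = \<Phi> (\<not> u) s t (e h)"
    if "\<not> P h" "0 \<le> g (\<not> u) (e h)" "g u (e h) < 0" for u h s t
    using that Z_e[of u h] by (auto simp: S_def Z_def)
  have e_Z: "e h \<in> Z u h \<longleftrightarrow> 0 \<le> g u (e h)" for u h
    using e(2) by (auto simp: Z_def)
  have SX: "S n \<inter> S (X n) \<noteq> {}" if "S n \<noteq> {}" for n
  proof -
    obtain u h s t where n: "n = (u, h, s, t)" by (metis prod_cases4)
    show ?thesis
    proof (cases "P h")
      case True
      then have "S n = (\<Union>z\<in>Z u h. \<Phi> u s t z)"
        by (simp add: S_def n)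
      then have "e h \<in> Z u h" using that Z_e by auto
      moreover have "\<Phi> u (\<not> s) t (e h) = \<Phi> u s t (e h)"
        using True by (auto simp: P_def)
      ultimately show ?thesis
        using True mem[of "e h" u h s t] mem[of "e h" u h "\<not> s" t] ne[of "e h" u s t] e(1)[of h] e_Z
        by (auto simp: X_def n)
    next
      case nP: False
      consider "\<forall>u. 0 \<le> g u (e h)" "(\<forall>s t. \<Phi> True s t (e h) = \<Phi> False s t (e h)) \<or> Q h"
        | u' where "0 \<le> g u' (e h)" "g (\<not> u') (e h) < 0"
        using ends'[of h] nP by blast
      then show ?thesis
      proof cases
        case 1
        then have "\<Phi> u s t (e h) \<subseteq> S n" "\<Phi> u s t (e h) \<subseteq> S (X n)"
          using mem[of "e h" u h s t] mem[of "e h" "\<not> u" h "\<not> s" "\<not> t"] mem[of "e h" "\<not> u" h s t] nP e_Z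
          by (cases u; auto simp: X_def n Q_def)+
        then show ?thesis
          using ne[of "e h" u s t] 1(1) e(1)[of h] by auto
      next
        case 2
        \<comment> \<open>Only arc \<open>u'\<close> is present at this end. The piece of the other
          arc is the borrowed end fibre of \<open>u'\<close>, and \<open>X\<close>, which swaps the
          arcs, pairs it with the piece that really contains this fibre.\<close>
        then have "\<not> Q h" by (auto simp: Q_def not_le[symmetric])
        then have "X n = (\<not> u, h, s, t)" using nP by (simp add: X_def n)
        moreover have "S (\<not> u', h, s, t) = \<Phi> u' s t (e h)"
          using virt[of h "\<not> u'" s t] 2 nP by simp
        moreover have "\<Phi> u' s t (e h) \<subseteq> S (u', h, s, t)"
          using mem e_Z 2 by blast
        ultimately show ?thesis
          using ne[of "e h" u' s t] 2(1) e(1)[of h] by (cases "u = u'") (auto simp: n)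
      qed
    qed
  qed
  have SY: "S n \<inter> S (Y n) \<noteq> {}" if "S n \<noteq> {}" for n
  proof -
    obtain u h s t where n: "n = (u, h, s, t)" by (metis prod_cases4)
    show ?thesis
    proof (cases "Z u h = {}")
      case False
      show ?thesis
      proof (cases "R u")
        case True
        then obtain z where z: "z \<in> Z u h" "g u z = 0"
          using Z_0 False by blast
        then have "z \<in> {a..b}" using Z_sub by blast
        then show ?thesis
          using fold[of z u s t] ne[of z u s t] mem[OF z(1), of s t] mem[OF z(1), of s "\<not> t"] z(2) True
          by (auto simp: n Y_def)
      next
        case nR: False
        then show ?thesis
          using ne[of "m u" u s t] mem[OF Z_m[OF nR, of h], of s t] mem[OF Z_m[OF nR, of "\<not> h"], of s t] m[of u]
          by (auto simp: n Y_def R_def)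
      qed
    next
      case True
      then have nP: "\<not> P h" and g: "0 \<le> g (\<not> u) (e h)"
        using that by (auto simp: n S_def split: if_splits)
      have neg: "g u (e h) < 0" using True e_Z[of h u] by auto
      then have "R u" using le[OF e(1), of u h] by (simp add: R_def)
      then have Y: "Y n = (u, h, s, \<not> t)" by (simp add: Y_def n)
      \<comment> \<open>A borrowed fibre occurs only where the other arc enters through a side of
        the rectangle, and there \<open>t\<close> makes no difference. So the switch of
        \<open>t\<close> made by \<open>Y\<close> stays inside the same set.\<close>
      obtain u' where u': "0 \<le> g u' (e h)" "\<forall>s t. \<Phi> u' s (\<not> t) (e h) = \<Phi> u' s t (e h)"
        using ends'[of h] nP neg by (metis not_le)
      then have "u' = (\<not> u)" using neg by (cases "u' = u") auto
      then have "S (u, h, s, \<not> t) = S (u, h, s, t)"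
        using u'(2) virt[OF nP g neg] by simp
      then show ?thesis using that Y by (simp add: n)
    qed
  qed
  have S_conn: "connected (S n)" for n
  proof -
    obtain u h s t where n: "n = (u, h, s, t)" by (metis prod_cases4)
    have "connected (\<Union>z\<in>Z u h. \<Phi> u s t z)"
      using conn[OF Z_conn Z_comp Z_sub] .
    then show ?thesis
      using single e(1) by (auto simp: n S_def)
  qed
  have XX: "X (X n) = n" "X n \<noteq> n" "Y n \<noteq> n" "X n \<noteq> Y n" for n
    by (cases n; auto simp: X_def Y_def)+
  have U: "(\<Union>n. S n) = C"
  proof (intro subset_antisym subsetI)
    fix x assume "x \<in> (\<Union>n. S n)"
    then obtain u h s t where "x \<in> S (u, h, s, t)" by auto
    then show "x \<in> C"
      using Z_sub[of u h] e(1)[of h] unfolding S_def C_def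
      by (auto split: if_splits) blast+
  next
    fix x assume "x \<in> C"
    then obtain u s t z where x: "x \<in> \<Phi> u s t z" "z \<in> {a..b}" "0 \<le> g u z"
      by (auto simp: C_def)
    then have "z \<in> Z u (m u \<le> z)"
      by (auto simp: Z_def H_def)
    then have "x \<in> S (u, m u \<le> z, s, t)"
      using x(1) by (auto simp: S_def)
    then show "x \<in> (\<Union>n. S n)" by blast
  qed
  have "finite (components (\<Union>n. S n)) \<and>
      4 * card (components (\<Union>n. S n)) \<le> CARD(bool \<times> bool \<times> bool \<times> bool)"
    by (rule card_components_le[of S X Y]) (use S_conn XX SX SY in blast)+
  then show ?thesis by (simp add: U)
qed

text \<open>Since the lower arc lies below the upper one, nothing is in the strip
  \<open>c..d\<close> where the upper arc is below \<open>c\<close> or the lower arc above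
  \<open>d\<close>. Unimodality makes the remaining parameters an interval \<open>W\<close>. On
  \<open>W\<close> each arc has one constraint left, upper at most \<open>d\<close> and lower at
  least \<open>c\<close>, and both constraints have the shape of a valley.\<close>

lemma card_components_unimodal:
  fixes y :: "bool \<Rightarrow> real \<Rightarrow> real" and \<Phi> :: "bool \<Rightarrow> bool \<Rightarrow> bool \<Rightarrow> real \<Rightarrow> 'a::topological_space set"
  assumes "c \<le> d"
    and cont: "\<And>u. continuous_on {a..b} (y u)"
    and le: "\<And>z. z \<in> {a..b} \<Longrightarrow> y False z \<le> y True z"
    and m: "\<And>u. m u \<in> {a..b}"
    and top: "mono_on {a..m True} (y True)" "antimono_on {m True..b} (y True)"
    and bot: "antimono_on {a..m False} (y False)" "mono_on {m False..b} (y False)"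
    and conn: "\<And>u s t J. connected J \<Longrightarrow> compact J \<Longrightarrow> J \<subseteq> {z \<in> {a..b}. y u z \<in> {c..d}} \<Longrightarrow>
      connected (\<Union>z\<in>J. \<Phi> u s t z)"
    and ne: "\<And>u s t z. z \<in> {a..b} \<Longrightarrow> y u z \<in> {c..d} \<Longrightarrow> \<Phi> u s t z \<noteq> {}"
    and fold: "\<And>u s t z. z \<in> {a..b} \<Longrightarrow> y u z \<in> {c, d} \<Longrightarrow> \<Phi> u s (\<not> t) z = \<Phi> u s t z"
    and meet: "\<And>z. z \<in> {a..b} \<Longrightarrow> y True z = y False z \<Longrightarrow>
      (\<forall>s t. \<Phi> True s t z = \<Phi> False s t z) \<or> (\<forall>s t. \<Phi> True s t z = \<Phi> False (\<not> s) (\<not> t) z)"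
    and ends: "\<And>e. e \<in> {a, b} \<Longrightarrow>
      (\<forall>u s t. \<Phi> u (\<not> s) t e = \<Phi> u s t e) \<or> y True e = y False e"
  defines "C \<equiv> \<Union>u s t. \<Union>z\<in>{z \<in> {a..b}. y u z \<in> {c..d}}. \<Phi> u s t z"
  shows "finite (components C) \<and> card (components C) \<le> 4"
proof -
  define h where "h z = min (y True z - c) (d - y False z)" for z
  define g where "g u z = (if u then d - y True z else y False z - c)" for u z
  define W where "W = {z \<in> {a..b}. 0 \<le> h z}"
  have W_iff: "y u z \<in> {c..d} \<longleftrightarrow> z \<in> W \<and> 0 \<le> g u z" if "z \<in> {a..b}" for u z
    using le[OF that] that by (cases u) (auto simp: W_def h_def g_def)
  have h_cont: "continuous_on {a..b} h"
    unfolding h_def using cont[of True] cont[of False] by (intro continuous_intros) auto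
  have "closed ({a..b} \<inter> h -` {0..})"
    using h_cont by (intro continuous_closed_preimage) auto
  moreover have W_eq: "{a..b} \<inter> h -` {0..} = W" by (auto simp: W_def)
  ultimately have "closed W" by simp
  moreover have "bounded W"
    by (rule bounded_subset[OF bounded_closed_interval[of a b]]) (auto simp: W_def)
  ultimately have W_comp: "compact W" by (simp add: compact_eq_bounded_closed)
  have "is_interval W"
    unfolding is_interval_1
  proof (intro ballI allI impI)
    fix z1 z2 z assume z: "z1 \<in> W" "z2 \<in> W" "z1 \<le> z \<and> z \<le> z2"
    then have ab: "z1 \<in> {a..b}" "z2 \<in> {a..b}" "z \<in> {a..b}"
      by (auto simp: W_def)
    have "c \<le> y True z"
    proof (cases "z \<le> m True")
      case True
      then have "y True z1 \<le> y True z"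
        using z ab top(1) by (auto simp: monotone_on_def)
      then show ?thesis using z(1) by (simp add: W_def h_def)
    next
      case False
      then have "y True z2 \<le> y True z"
        using z ab top(2) by (auto simp: monotone_on_def)
      then show ?thesis using z(2) by (simp add: W_def h_def)
    qed
    moreover have "y False z \<le> d"
    proof (cases "z \<le> m False")
      case True
      then have "y False z \<le> y False z1"
        using z ab bot(1) by (auto simp: monotone_on_def)
      then show ?thesis using z(1) by (simp add: W_def h_def)
    next
      case False
      then have "y False z \<le> y False z2"
        using z ab bot(2) by (auto simp: monotone_on_def)
      then show ?thesis using z(2) by (simp add: W_def h_def)
    qed
    ultimately show "z \<in> W" using ab by (simp add: W_def h_def)
  qed
  then have "connected W" by (simp add: is_interval_connected_1)
  then obtain a' b' where ab': "W = {a'..b'}"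
    using W_comp connected_compact_interval_1 by blast
  show ?thesis
  proof (cases "W = {}")
    case True
    then have "C = {}" using W_iff by (auto simp: C_def)
    then show ?thesis by simp
  next
    case False
    then have "a' \<le> b'" using ab' by auto
    then have sub: "a \<le> a'" "b' \<le> b"
      using ab' by (auto simp: W_def set_eq_iff)
    define m' where "m' u = max a' (min (m u) b')" for u
    have C_eq: "C = (\<Union>u s t. \<Union>z\<in>{z \<in> {a'..b'}. 0 \<le> g u z}. \<Phi> u s t z)"
    proof -
      have "z \<in> {a..b} \<and> y u z \<in> {c..d} \<longleftrightarrow> z \<in> {a'..b'} \<and> 0 \<le> g u z" for u z
        using W_iff[of z u] sub unfolding ab' by auto
      then show ?thesis by (simp add: C_def)
    qed
    \<comment> \<open>An end of \<open>W\<close> in the interior arises because one of the two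
      discarded conditions becomes tight there; \<open>k\<close> is the old end on the same side,
      where the condition fails.\<close>
    have inner: "h e = 0" if "e \<in> {a', b'}" "e \<notin> {a, b}" for e
    proof -
      define k where "k = (if e = a' then a else b)"
      have "k \<in> {a..b}" "k \<notin> W" "e \<in> W"
        using that sub \<open>a' \<le> b'\<close> by (auto simp: k_def ab')
      then have "h k < 0" "0 \<le> h e" by (auto simp: W_def)
      moreover have "connected (h ` closed_segment k e)"
        using \<open>k \<in> {a..b}\<close> \<open>e \<in> W\<close>
        by (intro connected_continuous_image continuous_on_subset[OF h_cont])
          (auto simp: W_def closed_segment_eq_real_ivl split: if_splits)
      ultimately have "0 \<in> h ` closed_segment k e"
        by (meson connectedD_interval ends_in_segment imageI less_imp_le)
      then obtain z where z: "z \<in> closed_segment k e" "h z = 0" by auto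
      then have "z \<in> W"
        using \<open>k \<in> {a..b}\<close> \<open>e \<in> W\<close>
        by (auto simp: W_def closed_segment_eq_real_ivl split: if_splits)
      then have "z = e"
        using z(1) sub that by (auto simp: ab' k_def closed_segment_eq_real_ivl split: if_splits)
      then show ?thesis using z(2) by simp
    qed
    have y_in: "y u z \<in> {c..d}" if "z \<in> {a'..b'}" "0 \<le> g u z" for u z
      using W_iff[of z u] that sub unfolding ab' by auto
    have g0: "g u z = 0 \<Longrightarrow> y u z \<in> {c, d}" for u z
      by (auto simp: g_def split: if_splits)
    show ?thesis unfolding C_eq
    proof (rule card_components_two_valleys[where m = m'])
      show "a' \<le> b'" by fact
      show "continuous_on {a'..b'} (g u)" for u
      proof -
        have "continuous_on {a'..b'} (y u)"
          using sub by (intro continuous_on_subset[OF cont]) auto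
        then show ?thesis
          unfolding g_def by (cases u) (auto intro!: continuous_intros)
      qed
      show "m' u \<in> {a'..b'}" for u
        using \<open>a' \<le> b'\<close> by (auto simp: m'_def)
      show "antimono_on {a'..m' u} (g u)" for u
      proof (rule monotone_onI)
        fix z1 z2 assume z: "z1 \<in> {a'..m' u}" "z2 \<in> {a'..m' u}" "z1 \<le> z2"
        \<comment> \<open>Clamping \<open>m u\<close> into \<open>{a'..b'}\<close> may leave a
          one-point interval on the wrong side of \<open>m u\<close>. Distinct points exclude
          this.\<close>
        show "g u z1 \<ge> g u z2"
        proof (cases "z1 = z2")
          case False
          then have "z1 \<in> {a..m u}" "z2 \<in> {a..m u}"
            using z sub by (auto simp: m'_def max_def min_def split: if_splits)
          then show ?thesis
            using z(3) top(1) bot(1) by (cases u) (auto simp: g_def monotone_on_def)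
        qed simp
      qed
      show "mono_on {m' u..b'} (g u)" for u
      proof (rule monotone_onI)
        fix z1 z2 assume z: "z1 \<in> {m' u..b'}" "z2 \<in> {m' u..b'}" "z1 \<le> z2"
        show "g u z1 \<le> g u z2"
        proof (cases "z1 = z2")
          case False
          then have "z1 \<in> {m u..b}" "z2 \<in> {m u..b}"
            using z sub by (auto simp: m'_def max_def min_def split: if_splits)
          then show ?thesis
            using z(3) top(2) bot(2) by (cases u) (auto simp: g_def monotone_on_def)
        qed simp
      qed
      show "connected (\<Union>z\<in>J. \<Phi> u s t z)"
        if "connected J" "compact J" "J \<subseteq> {z \<in> {a'..b'}. 0 \<le> g u z}" for u s t J
        using that y_in[of _ u] sub by (intro conn) force+
      show "\<Phi> u s t z \<noteq> {}" if "z \<in> {a'..b'}" "0 \<le> g u z" for u s t z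
        using that y_in[OF that] sub by (intro ne) auto
      show "\<Phi> u s (\<not> t) z = \<Phi> u s t z" if "z \<in> {a'..b'}" "g u z = 0" for u s t z
        using that g0[OF that(2)] sub by (intro fold) auto
      show "(\<forall>u s t. \<Phi> u (\<not> s) t e = \<Phi> u s t e) \<or>
        ((\<forall>u. 0 \<le> g u e) \<and> ((\<forall>s t. \<Phi> True s t e = \<Phi> False s t e) \<or>
          (\<forall>s t. \<Phi> True s t e = \<Phi> False (\<not> s) (\<not> t) e))) \<or>
        (\<exists>u. 0 \<le> g u e \<and> g (\<not> u) e < 0 \<and> (\<forall>s t. \<Phi> u s (\<not> t) e = \<Phi> u s t e))"
        if e: "e \<in> {a', b'}" for e
      proof -
        have eW: "e \<in> W" using e \<open>a' \<le> b'\<close> ab' by auto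
        then have eab: "e \<in> {a..b}" by (simp add: W_def)
        have w: "c \<le> y True e" "y False e \<le> d" using eW by (auto simp: W_def h_def)
        have "(\<forall>u s t. \<Phi> u (\<not> s) t e = \<Phi> u s t e) \<or> y True e = y False e \<or> y True e = c \<or> y False e = d"
        proof (cases "e \<in> {a, b}")
          case True
          then show ?thesis using ends by blast
        next
          case False
          then show ?thesis using inner[OF e] by (auto simp: h_def min_def split: if_splits)
        qed
        \<comment> \<open>At a tight end either the arcs meet, or exactly one of them is on the
          boundary of the strip and the other strictly outside. The latter is the situation with a
          borrowed fibre.\<close>
        then consider "\<forall>u s t. \<Phi> u (\<not> s) t e = \<Phi> u s t e" | "y True e = y False e"
          | "y True e = c" "y False e < c" | "y False e = d" "d < y True e"
          using le[OF eab] by (metis order_le_less)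
        then show ?thesis
        proof cases
          case 2
          then have "\<forall>u. 0 \<le> g u e" using w by (simp add: g_def)
          then show ?thesis using meet[OF eab 2] by blast
        next
          case 3
          then have "0 \<le> g True e" "g (\<not> True) e < 0" using \<open>c \<le> d\<close> by (auto simp: g_def)
          then show ?thesis using fold[OF eab, of True] 3 by blast
        next
          case 4
          then have "0 \<le> g False e" "g (\<not> False) e < 0" using \<open>c \<le> d\<close> by (auto simp: g_def)
          then show ?thesis using fold[OF eab, of False] 4 by blast
        qed blast
      qed
    qed
  qed
qed

section \<open>Apexes of a triangle\<close>

text \<open>The flag selects the side of the line \<open>A B\<close>. If \<open>A = B\<close>, both sides give the whole circle.\<close>

definition apexes :: "bool \<Rightarrow> real \<Rightarrow> real \<Rightarrow> complex \<Rightarrow> complex \<Rightarrow> complex set" where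
  "apexes s r r' A B = {P. dist P A = r \<and> dist P B = r' \<and>
    0 \<le> (if s then 1 else -1) * Im (cnj (B - A) * (P - A))}"

lemma apex_Re:
  fixes A B P :: complex
  shows "2 * Re (cnj (B - A) * (P - A)) = (dist A B)\<^sup>2 + (dist P A)\<^sup>2 - (dist P B)\<^sup>2"
  unfolding dist_norm cmod_power2 by (simp add: power2_eq_square algebra_simps)

text \<open>\<open>Im (cnj (B - A) * (P - A))\<close> is twice the signed area of the triangle, so
  this is Heron's formula without square roots.\<close>

lemma apex_Im:
  fixes A B P :: complex
  shows "4 * (Im (cnj (B - A) * (P - A)))\<^sup>2 =
    ((dist P A + dist P B)\<^sup>2 - (dist A B)\<^sup>2) * ((dist A B)\<^sup>2 - (dist P A - dist P B)\<^sup>2)"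
proof -
  have "4 * (Im w)\<^sup>2 = 4 * (cmod w)\<^sup>2 - (2 * Re w)\<^sup>2" for w
    by (simp add: cmod_power2 power_mult_distrib)
  then have "4 * (Im (cnj (B - A) * (P - A)))\<^sup>2 =
      4 * (cmod (cnj (B - A) * (P - A)))\<^sup>2 - (2 * Re (cnj (B - A) * (P - A)))\<^sup>2" .
  also have "cmod (cnj (B - A) * (P - A)) = dist A B * dist P A"
    by (simp only: norm_mult complex_mod_cnj dist_norm norm_minus_commute)
  also have "4 * (dist A B * dist P A)\<^sup>2 - (2 * Re (cnj (B - A) * (P - A)))\<^sup>2 =
      ((dist P A + dist P B)\<^sup>2 - (dist A B)\<^sup>2) * ((dist A B)\<^sup>2 - (dist P A - dist P B)\<^sup>2)"
    unfolding apex_Re by (simp add: power2_eq_square algebra_simps)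
  finally show ?thesis .
qed

text \<open>By Heron's formula a degenerate triangle has area 0, which makes the sign condition
  void.\<close>

lemma apexes_degenerate:
  assumes "dist A B \<in> {\<bar>r - r'\<bar>, r + r'}"
  shows "apexes (\<not> s) r r' A B = apexes s r r' A B"
proof -
  define f where "f P = Im (cnj (B - A) * (P - A))" for P
  have "f P = 0" if "dist P A = r" "dist P B = r'" for P
  proof -
    have "4 * (f P)\<^sup>2 = 0"
      unfolding f_def apex_Im using assms that by auto
    then show ?thesis by simp
  qed
  then show ?thesis unfolding apexes_def f_def[symmetric] by auto
qed

lemma apexes_cnj: "apexes (\<not> s) r r' (cnj A) (cnj B) = cnj ` apexes s r r' A B"
proof -
  have *: "cnj P \<in> apexes (\<not> s) r r' (cnj A) (cnj B)" if "P \<in> apexes s r r' A B" for P s A B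
  proof -
    have "dist (cnj P) (cnj A) = dist P A" "dist (cnj P) (cnj B) = dist P B"
      by (simp_all add: dist_norm flip: complex_cnj_diff)
    then show ?thesis
      using that by (auto simp: apexes_def algebra_simps)
  qed
  show ?thesis
  proof (intro subset_antisym subsetI)
    fix P assume "P \<in> apexes (\<not> s) r r' (cnj A) (cnj B)"
    then have "cnj P \<in> apexes s r r' A B" using *[of P "\<not> s" "cnj A" "cnj B"] by simp
    then show "P \<in> cnj ` apexes s r r' A B" by (metis complex_cnj_cnj imageI)
  qed (use * in auto)
qed

lemma apexes_nonempty:
  assumes "0 \<le> r" "0 \<le> r'" "dist A B \<in> {\<bar>r - r'\<bar>..r + r'}"
  shows "apexes s r r' A B \<noteq> {}"
proof (cases "A = B")
  case True
  \<comment> \<open>Here the triangle inequalities force \<open>r = r'\<close>, and every point of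
    the circle is an apex.\<close>
  then have "A + of_real r \<in> apexes s r r' A B"
    using assms by (auto simp: apexes_def dist_norm)
  then show ?thesis by blast
next
  case False
  define d where "d = dist A B"
  have d: "0 < d" using False by (simp add: d_def)
  \<comment> \<open>In the frame with origin \<open>A\<close> and first axis along
    \<open>B - A\<close>, the apex has coordinates \<open>x\<close>, from the law of cosines, and
    \<open>h\<close>, the altitude with the sign prescribed by \<open>s\<close>.\<close>
  define x where "x = (d\<^sup>2 + r\<^sup>2 - r'\<^sup>2) / (2 * d)"
  define h where "h = (if s then 1 else -1) * sqrt (r\<^sup>2 - x\<^sup>2)"
  define P where "P = A + (B - A) * Complex (x / d) (h / d)"
  have "4 * d\<^sup>2 * (r\<^sup>2 - x\<^sup>2) = ((r + r')\<^sup>2 - d\<^sup>2) * (d\<^sup>2 - (r - r')\<^sup>2)"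
    unfolding x_def using d by (simp add: field_simps power2_eq_square)
  moreover have "0 \<le> \<dots>"
  proof (rule mult_nonneg_nonneg)
    show "0 \<le> (r + r')\<^sup>2 - d\<^sup>2"
      using assms(3) d by (simp add: d_def power_mono)
    show "0 \<le> d\<^sup>2 - (r - r')\<^sup>2"
      using assms(3) d by (simp add: d_def abs_le_square_iff[symmetric])
  qed
  ultimately have "0 \<le> (4 * d\<^sup>2) * (r\<^sup>2 - x\<^sup>2)" by simp
  moreover have "0 < 4 * d\<^sup>2" using d by simp
  ultimately have "0 \<le> r\<^sup>2 - x\<^sup>2" using zero_le_mult_iff not_less by blast
  then have h2: "h\<^sup>2 = r\<^sup>2 - x\<^sup>2" by (simp add: h_def)
  have nBA: "cmod (B - A) = d" by (simp add: d_def dist_norm norm_minus_commute)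
  have "(cmod (Complex (x / d) (h / d)))\<^sup>2 = (r / d)\<^sup>2"
    using h2 by (simp add: cmod_power2 power_divide add_divide_distrib[symmetric])
  then have "cmod (Complex (x / d) (h / d)) = r / d"
    using assms(1) d by (simp add: power2_eq_iff_nonneg)
  then have PA: "dist P A = r"
    using d by (simp add: P_def dist_norm norm_mult nBA)
  have "P - B = (B - A) * Complex (x / d - 1) (h / d)"
    by (simp add: P_def complex_eq_iff algebra_simps)
  then have "(dist P B)\<^sup>2 = d\<^sup>2 * ((x / d - 1)\<^sup>2 + (h / d)\<^sup>2)"
    by (simp add: dist_norm norm_mult nBA power_mult_distrib cmod_power2)
  also have "\<dots> = x\<^sup>2 - 2 * x * d + d\<^sup>2 + h\<^sup>2"
    using d by (simp add: field_simps power2_eq_square)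
  also have "\<dots> = r'\<^sup>2"
    unfolding h2 using d by (simp add: x_def field_simps power2_eq_square)
  finally have PB: "dist P B = r'"
    using assms(2) by (simp add: power2_eq_iff_nonneg)
  have "Im (cnj (B - A) * (P - A)) = Im (cnj (B - A) * (B - A) * Complex (x / d) (h / d))"
    by (simp only: P_def add_diff_cancel_left' mult.assoc)
  also have "cnj (B - A) * (B - A) = of_real (d\<^sup>2)"
    by (metis complex_norm_square mult.commute nBA)
  finally have "Im (cnj (B - A) * (P - A)) = d * h"
    using d by (simp add: power2_eq_square)
  then have "P \<in> apexes s r r' A B"
    using PA PB d \<open>0 \<le> r\<^sup>2 - x\<^sup>2\<close> by (simp add: apexes_def h_def)
  then show ?thesis by blast
qed

text \<open>For distinct base points there is at most one apex: the law of cosines fixes the real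
  part of \<open>cnj (B - A) * (P - A)\<close>, Heron's formula its imaginary part up to the sign,
  and the flag the sign. For equal base points it is a circle or empty.\<close>

lemma connected_apexes: "connected (apexes s r r' A B)"
proof (cases "A = B")
  case True
  then have "apexes s r r' A B = (if r = r' then sphere A r else {})"
    by (auto simp: apexes_def dist_commute)
  then show ?thesis by (simp add: connected_sphere)
next
  case False
  have "P = P'" if P: "P \<in> apexes s r r' A B" and P': "P' \<in> apexes s r r' A B" for P P'
  proof -
    define f where "f P = cnj (B - A) * (P - A)" for P
    have "2 * Re (f P) = 2 * Re (f P')"
      unfolding f_def apex_Re using P P' by (simp add: apexes_def)
    moreover have "4 * (Im (f P))\<^sup>2 = 4 * (Im (f P'))\<^sup>2"
      unfolding f_def apex_Im using P P' by (simp add: apexes_def)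
    then have "Im (f P) = Im (f P')"
      using P P' unfolding apexes_def f_def[symmetric] by (cases s) (auto simp: power2_eq_iff)
    ultimately have "f P = f P'" by (simp add: complex_eq_iff)
    then have "cnj (B - A) * (P - A) = cnj (B - A) * (P' - A)" by (simp only: f_def)
    moreover have "cnj (B - A) \<noteq> 0" using False by simp
    ultimately have "P - A = P' - A" using mult_left_cancel by blast
    then show ?thesis by simp
  qed
  then have "apexes s r r' A B = {} \<or> (\<exists>P. apexes s r r' A B = {P})" by blast
  then show ?thesis by auto
qed

text \<open>When the base points merge, a fibre jumps from a point to a circle, so no continuous
  section is available. Instead the total space over \<open>J\<close> is compact, hence its
  projection to \<open>J\<close> is a closed map. A closed surjection with connected fibres onto a
  connected set has a connected domain.\<close>

lemma connected_dist_apexes: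
  fixes A B D E :: "real \<Rightarrow> complex"
  assumes J: "connected J" "compact J"
    and cont: "continuous_on J A" "continuous_on J B" "continuous_on J D" "continuous_on J E"
    and ne: "\<And>z. z \<in> J \<Longrightarrow> apexes s r1 r2 (A z) (B z) \<noteq> {}"
      "\<And>z. z \<in> J \<Longrightarrow> apexes t r3 r4 (D z) (E z) \<noteq> {}"
  shows "connected (\<Union>z\<in>J. {dist P Q | P Q. P \<in> apexes s r1 r2 (A z) (B z) \<and> Q \<in> apexes t r3 r4 (D z) (E z)})"
proof -
  define W where "W = {(z, P, Q). z \<in> J \<and> P \<in> apexes s r1 r2 (A z) (B z) \<and> Q \<in> apexes t r3 r4 (D z) (E z)}"
  have fW: "fst ` W = J"
    using ne by (force simp: W_def image_iff)
  have "compact W"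
  proof -
    \<comment> \<open>The apexes stay within a fixed distance of the bounded curves \<open>A\<close>
      and \<open>D\<close>, so the total space is a closed subset of the compact set
      \<open>K\<close>.\<close>
    obtain M where M: "\<And>z. z \<in> J \<Longrightarrow> cmod (A z) \<le> M"
      using compact_imp_bounded[OF compact_continuous_image[OF cont(1) J(2)]]
      by (auto simp: bounded_iff)
    obtain N where N: "\<And>z. z \<in> J \<Longrightarrow> cmod (D z) \<le> N"
      using compact_imp_bounded[OF compact_continuous_image[OF cont(3) J(2)]]
      by (auto simp: bounded_iff)
    define K where "K = J \<times> cball (0::complex) (M + r1) \<times> cball (0::complex) (N + r3)"
    define F where "F = (\<lambda>(z, P, Q). (dist P (A z), dist P (B z), dist Q (D z), dist Q (E z),
      (if s then 1 else -1) * Im (cnj (B z - A z) * (P - A z)),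
      (if t then 1 else -1) * Im (cnj (E z - D z) * (Q - D z))))"
    have "compact K"
      unfolding K_def using J(2) by (intro compact_Times) auto
    have cK: "continuous_on K (\<lambda>x. f (fst x))" if "continuous_on J f" for f :: "real \<Rightarrow> complex"
      using that by (rule continuous_on_compose2) (auto simp: K_def intro!: continuous_intros)
    have "continuous_on K F"
      unfolding F_def case_prod_beta by (intro continuous_intros cK cont)
    then have "closedin (top_of_set K) (K \<inter> F -` ({r1} \<times> {r2} \<times> {r3} \<times> {r4} \<times> {0..} \<times> {0..}))"
      by (intro continuous_closedin_preimage closed_Times) auto
    moreover have "K \<inter> F -` ({r1} \<times> {r2} \<times> {r3} \<times> {r4} \<times> {0..} \<times> {0..}) = W"
    proof -
      have "cmod P \<le> M + r1" if "z \<in> J" "dist P (A z) = r1" for z P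
        using M[OF that(1)] that(2) norm_triangle_sub[of P "A z"] by (simp add: dist_norm)
      moreover have "cmod Q \<le> N + r3" if "z \<in> J" "dist Q (D z) = r3" for z Q
        using N[OF that(1)] that(2) norm_triangle_sub[of Q "D z"] by (simp add: dist_norm)
      ultimately show ?thesis
        unfolding K_def F_def W_def apexes_def by auto
    qed
    ultimately show ?thesis
      using \<open>compact K\<close> closedin_compact by metis
  qed
  have "connected (W \<inter> fst -` J)"
  proof (rule connected_closed_monotone_preimage[OF _ fW])
    show "continuous_on W fst" by (intro continuous_intros)
    show "closedin (top_of_set J) (fst ` C)" if "closedin (top_of_set W) C" for C
    proof -
      have "compact C" using that \<open>compact W\<close> closedin_compact by blast
      then have "compact (fst ` C)"
        by (intro compact_continuous_image continuous_intros)
      moreover have "fst ` C \<subseteq> J" using closedin_subset[OF that] fW by auto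
      ultimately show ?thesis
        using J(2) by (simp add: closed_subset compact_imp_closed)
    qed
    show "connected (W \<inter> fst -` {z})" if "z \<in> J" for z
    proof -
      have "W \<inter> fst -` {z} = {z} \<times> apexes s r1 r2 (A z) (B z) \<times> apexes t r3 r4 (D z) (E z)"
        using that by (auto simp: W_def)
      then show ?thesis by (simp add: connected_Times connected_apexes)
    qed
  qed (use J in auto)
  moreover have "W \<inter> fst -` J = W" by (auto simp: W_def)
  ultimately have "connected W" by simp
  then have "connected ((\<lambda>w. dist (fst (snd w)) (snd (snd w))) ` W)"
    by (intro connected_continuous_image continuous_intros)
  moreover have "(\<lambda>w. dist (fst (snd w)) (snd (snd w))) ` W =
    (\<Union>z\<in>J. {dist P Q | P Q. P \<in> apexes s r1 r2 (A z) (B z) \<and> Q \<in> apexes t r3 r4 (D z) (E z)})"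
    by (force simp: W_def)
  ultimately show ?thesis by simp
qed

section \<open>The two arcs of a linkage in normal position\<close>

lemma dist_cnj_cnj [simp]: "dist (cnj x) (cnj y) = dist x y"
  by (simp add: dist_norm flip: complex_cnj_diff)

text \<open>The sign of the correction term decides which position of \<open>v6\<close> is farther
  from \<open>v4\<close>; the two distances agree exactly if one of the two points lies on the
  axis.\<close>

lemma dist_cnj_right: "(dist x (cnj y))\<^sup>2 = (dist x y)\<^sup>2 + 4 * Im x * Im y"
  unfolding dist_norm cmod_power2 by (simp add: power2_eq_square algebra_simps)

lemma dist_bounds:
  fixes P :: "'a::metric_space"
  shows "dist A B \<in> {\<bar>dist P A - dist P B\<bar>..dist P A + dist P B}"
  using dist_triangle3[of A B P] dist_triangle[of P A B] dist_triangle2[of P B A]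
  by (auto simp: dist_commute)

text \<open>Normal position: \<open>v1 = 0\<close>, \<open>v3 = B z\<close> on the real axis,
  \<open>v4 = D z\<close> above it, and \<open>v6\<close> either \<open>E z\<close> below it or the
  mirror image. The first choice gives the upper arc. The parameter is abstract so that it may also
  run through positions with \<open>v1 = v3\<close>.\<close>

lemma card_components_linkage:
  fixes B :: "real \<Rightarrow> real" and D E :: "real \<Rightarrow> complex" and m :: "bool \<Rightarrow> real"
  assumes r: "0 \<le> r1" "0 \<le> r2" "0 \<le> r3" "0 \<le> r4"
    and cont: "continuous_on {a..b} B" "continuous_on {a..b} D" "continuous_on {a..b} E"
    and Im: "\<And>z. z \<in> {a..b} \<Longrightarrow> 0 \<le> Im (D z)" "\<And>z. z \<in> {a..b} \<Longrightarrow> Im (E z) \<le> 0"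
    and B: "\<And>z. z \<in> {a..b} \<Longrightarrow> \<bar>B z\<bar> \<in> {\<bar>r1 - r2\<bar>..r1 + r2}"
    and m: "\<And>u. m u \<in> {a..b}"
    and top: "mono_on {a..m True} (\<lambda>z. dist (D z) (E z))"
      "antimono_on {m True..b} (\<lambda>z. dist (D z) (E z))"
    and bot: "antimono_on {a..m False} (\<lambda>z. dist (D z) (cnj (E z)))"
      "mono_on {m False..b} (\<lambda>z. dist (D z) (cnj (E z)))"
    and ends: "\<And>e. e \<in> {a, b} \<Longrightarrow> \<bar>B e\<bar> \<in> {\<bar>r1 - r2\<bar>, r1 + r2} \<or> Im (D e) * Im (E e) = 0"
  defines "C \<equiv> {dist P Q | P Q z F. z \<in> {a..b} \<and> (F = E z \<or> F = cnj (E z)) \<and>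
    dist P 0 = r1 \<and> dist P (of_real (B z)) = r2 \<and> dist Q (D z) = r3 \<and> dist Q F = r4}"
  shows "finite (components C) \<and> card (components C) \<le> 4"
proof -
  define F where "F u z = (if u then E z else cnj (E z))" for u z
  define y where "y u z = dist (D z) (F u z)" for u z
  define \<Phi> where "\<Phi> u s t z = {dist P Q | P Q. P \<in> apexes s r1 r2 0 (of_real (B z)) \<and>
    Q \<in> apexes t r3 r4 (D z) (F u z)}" for u s t z
  have F_cont: "continuous_on {a..b} (F u)" for u
    unfolding F_def using cont by (cases u) (auto intro: continuous_intros)
  have P_ne: "apexes s r1 r2 0 (complex_of_real (B z)) \<noteq> {}" if "z \<in> {a..b}" for s z
    using B[OF that] r by (intro apexes_nonempty) auto
  have Q_ne: "apexes t r3 r4 (D z) (F u z) \<noteq> {}" if "y u z \<in> {\<bar>r3 - r4\<bar>..r3 + r4}" for t u z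
    using that r by (intro apexes_nonempty) (auto simp: y_def)
  have y_eq: "y True z = y False z \<longleftrightarrow> Im (D z) * Im (E z) = 0" for z
  proof -
    have "y True z = y False z \<longleftrightarrow> (y True z)\<^sup>2 = (y False z)\<^sup>2"
      by (simp add: y_def power2_eq_iff_nonneg)
    then show ?thesis
      using dist_cnj_right[of "D z" "E z"] by (simp add: y_def F_def)
  qed
  have C_eq: "C = (\<Union>u s t. \<Union>z\<in>{z \<in> {a..b}. y u z \<in> {\<bar>r3 - r4\<bar>..r3 + r4}}. \<Phi> u s t z)"
  proof (intro subset_antisym subsetI)
    fix x assume "x \<in> C"
    then obtain P Q z G where *: "x = dist P Q" "z \<in> {a..b}" "G = E z \<or> G = cnj (E z)"
      "dist P 0 = r1" "dist P (of_real (B z)) = r2" "dist Q (D z) = r3" "dist Q G = r4"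
      unfolding C_def by blast
    obtain u where u: "G = F u z"
      using *(3) by (metis F_def)
    obtain s where s: "P \<in> apexes s r1 r2 0 (of_real (B z))"
    proof -
      have "P \<in> apexes True r1 r2 0 (of_real (B z)) \<or> P \<in> apexes False r1 r2 0 (of_real (B z))"
        using * unfolding apexes_def by simp linarith
      then show ?thesis using that by blast
    qed
    obtain t where t: "Q \<in> apexes t r3 r4 (D z) (F u z)"
    proof -
      have "Q \<in> apexes True r3 r4 (D z) (F u z) \<or> Q \<in> apexes False r3 r4 (D z) (F u z)"
        using * u unfolding apexes_def by simp linarith
      then show ?thesis using that by blast
    qed
    have "y u z \<in> {\<bar>r3 - r4\<bar>..r3 + r4}"
      using dist_bounds[of "D z" "F u z" Q] * u by (simp add: y_def)
    moreover have "x \<in> \<Phi> u s t z" using s t *(1) by (auto simp: \<Phi>_def)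
    ultimately show "x \<in> (\<Union>u s t. \<Union>z\<in>{z \<in> {a..b}. y u z \<in> {\<bar>r3 - r4\<bar>..r3 + r4}}. \<Phi> u s t z)"
      using *(2) by blast
  next
    fix x assume "x \<in> (\<Union>u s t. \<Union>z\<in>{z \<in> {a..b}. y u z \<in> {\<bar>r3 - r4\<bar>..r3 + r4}}. \<Phi> u s t z)"
    then obtain u s t z where z: "z \<in> {a..b}" "x \<in> \<Phi> u s t z" by blast
    then obtain P Q where "x = dist P Q"
      "P \<in> apexes s r1 r2 0 (of_real (B z))" "Q \<in> apexes t r3 r4 (D z) (F u z)"
      unfolding \<Phi>_def by blast
    moreover have "F u z = E z \<or> F u z = cnj (E z)" by (simp add: F_def)
    ultimately show "x \<in> C"
      using z(1) unfolding C_def apexes_def by blast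
  qed
  show ?thesis unfolding C_eq
  proof (rule card_components_unimodal[where m = m])
    show "\<bar>r3 - r4\<bar> \<le> r3 + r4" using r by auto
    show "continuous_on {a..b} (y u)" for u
      unfolding y_def using cont F_cont by (intro continuous_intros)
    show "y False z \<le> y True z" if "z \<in> {a..b}" for z
    proof -
      have "Im (D z) * Im (E z) \<le> 0"
        using Im[OF that] by (rule mult_nonneg_nonpos)
      then have "(y False z)\<^sup>2 \<le> (y True z)\<^sup>2"
        using dist_cnj_right[of "D z" "E z"] by (simp add: y_def F_def)
      then show ?thesis by (rule power2_le_imp_le) (simp add: y_def)
    qed
    show "m u \<in> {a..b}" for u by (rule m)
    have "y True = (\<lambda>z. dist (D z) (E z))" "y False = (\<lambda>z. dist (D z) (cnj (E z)))"
      by (simp_all add: fun_eq_iff y_def F_def)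
    then show "mono_on {a..m True} (y True)" "antimono_on {m True..b} (y True)"
      "antimono_on {a..m False} (y False)" "mono_on {m False..b} (y False)"
      using top bot by simp_all
    show "connected (\<Union>z\<in>J. \<Phi> u s t z)"
      if "connected J" "compact J" "J \<subseteq> {z \<in> {a..b}. y u z \<in> {\<bar>r3 - r4\<bar>..r3 + r4}}" for u s t J
    proof -
      note J' = that(3)
      then have J: "J \<subseteq> {a..b}" by blast
      show ?thesis unfolding \<Phi>_def
      proof (rule connected_dist_apexes[OF that(1,2)])
        show "continuous_on J (\<lambda>z. complex_of_real (B z))"
          by (intro continuous_intros continuous_on_subset[OF cont(1) J])
        show "continuous_on J D" "continuous_on J (F u)"
          using cont F_cont J continuous_on_subset by blast+
        show "apexes s r1 r2 0 (complex_of_real (B z)) \<noteq> {}" if "z \<in> J" for z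
          using that J P_ne by blast
        show "apexes t r3 r4 (D z) (F u z) \<noteq> {}" if "z \<in> J" for z
          using that J' Q_ne by blast
      qed (rule continuous_on_const)
    qed
    show "\<Phi> u s t z \<noteq> {}" if "z \<in> {a..b}" "y u z \<in> {\<bar>r3 - r4\<bar>..r3 + r4}" for u s t z
      using P_ne[OF that(1), of s] Q_ne[OF that(2), of t] by (auto simp: \<Phi>_def)
    show "\<Phi> u s (\<not> t) z = \<Phi> u s t z" if "z \<in> {a..b}" "y u z \<in> {\<bar>r3 - r4\<bar>, r3 + r4}" for u s t z
      using that(2) unfolding \<Phi>_def y_def by (subst apexes_degenerate) auto
    show "(\<forall>s t. \<Phi> True s t z = \<Phi> False s t z) \<or> (\<forall>s t. \<Phi> True s t z = \<Phi> False (\<not> s) (\<not> t) z)"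
      if "z \<in> {a..b}" "y True z = y False z" for z
    proof (cases "Im (E z) = 0")
      case True
      then have "F True z = F False z" by (simp add: F_def complex_eq_iff)
      then show ?thesis by (simp add: \<Phi>_def)
    next
      case False
      \<comment> \<open>The other arc is reached by reflecting the figure in the real axis. This
        fixes \<open>v1\<close>, \<open>v3\<close> and \<open>v4\<close>, exchanges the two
        positions of \<open>v6\<close> and flips both sides.\<close>
      then have "Im (D z) = 0" using that(2) y_eq by auto
      then have D: "D z = cnj (D z)" by (simp add: complex_eq_iff)
      have "\<Phi> False (\<not> s) (\<not> t) z = \<Phi> True s t z" for s t
      proof -
        have "apexes (\<not> t) r3 r4 (D z) (F False z) = cnj ` apexes t r3 r4 (D z) (F True z)"
          by (subst D) (simp add: F_def apexes_cnj)
        moreover have "apexes (\<not> s) r1 r2 0 (complex_of_real (B z)) =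
            cnj ` apexes s r1 r2 0 (complex_of_real (B z))"
          using apexes_cnj[of s r1 r2 0 "complex_of_real (B z)"] by simp
        ultimately have "\<Phi> False (\<not> s) (\<not> t) z =
            {dist P Q | P Q. P \<in> cnj ` apexes s r1 r2 0 (complex_of_real (B z)) \<and>
              Q \<in> cnj ` apexes t r3 r4 (D z) (F True z)}"
          by (simp add: \<Phi>_def)
        also have "\<dots> = {dist (cnj P) (cnj Q) | P Q. P \<in> apexes s r1 r2 0 (complex_of_real (B z)) \<and>
              Q \<in> apexes t r3 r4 (D z) (F True z)}"
          by blast
        also have "\<dots> = \<Phi> True s t z"
          by (simp add: \<Phi>_def)
        finally show ?thesis .
      qed
      then show ?thesis by blast
    qed
    show "(\<forall>u s t. \<Phi> u (\<not> s) t e = \<Phi> u s t e) \<or> y True e = y False e" if "e \<in> {a, b}" for e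
    proof (cases "Im (D e) * Im (E e) = 0")
      case False
      then have "dist 0 (complex_of_real (B e)) \<in> {\<bar>r1 - r2\<bar>, r1 + r2}"
        using ends[OF that] by auto
      then show ?thesis by (simp add: \<Phi>_def apexes_degenerate)
    qed (simp add: y_eq)
  qed
qed

section \<open>Four-bar linkages\<close>

text \<open>The isometry in \<open>cover\<close> acts on the whole plane, so it carries
  \<open>w2\<close> and \<open>w5\<close> along and preserves their distance. The range assumed for
  \<open>dist w1 w3\<close> is available because \<open>w2\<close> completes a triangle over
  it.\<close>

lemma linkage_values_eq:
  fixes B :: "real \<Rightarrow> real" and D E :: "real \<Rightarrow> complex"
  assumes sides: "\<And>z. z \<in> Z \<Longrightarrow> cmod (D z) = p" "\<And>z. z \<in> Z \<Longrightarrow> dist (of_real (B z)) (D z) = q"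
      "\<And>z. z \<in> Z \<Longrightarrow> dist (of_real (B z)) (E z) = r" "\<And>z. z \<in> Z \<Longrightarrow> cmod (E z) = s"
    and cover: "\<And>w1 w3 w4 w6 :: complex. dist w1 w4 = p \<Longrightarrow> dist w3 w4 = q \<Longrightarrow> dist w3 w6 = r \<Longrightarrow>
      dist w1 w6 = s \<Longrightarrow> dist w1 w3 \<in> {\<bar>r1 - r2\<bar>..r1 + r2} \<Longrightarrow>
      \<exists>f z. (\<forall>x y. dist (f x) (f y) = dist x y) \<and> z \<in> Z \<and> f w1 = 0 \<and> f w3 = of_real (B z) \<and>
        f w4 = D z \<and> (f w6 = E z \<or> f w6 = cnj (E z))"
  shows "{dist w2 w5 | w1 w2 w3 w4 w5 w6 :: complex. dist w1 w4 = p \<and> dist w3 w4 = q \<and>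
      dist w3 w6 = r \<and> dist w1 w6 = s \<and> dist w2 w1 = r1 \<and> dist w2 w3 = r2 \<and>
      dist w5 w4 = r3 \<and> dist w5 w6 = r4} =
    {dist P Q | P Q z F. z \<in> Z \<and> (F = E z \<or> F = cnj (E z)) \<and>
      dist P 0 = r1 \<and> dist P (of_real (B z)) = r2 \<and> dist Q (D z) = r3 \<and> dist Q F = r4}"
    (is "?L = ?R")
proof (intro subset_antisym subsetI)
  fix x assume "x \<in> ?L"
  then obtain w1 w2 w3 w4 w5 w6 :: complex where w: "x = dist w2 w5" "dist w1 w4 = p"
    "dist w3 w4 = q" "dist w3 w6 = r" "dist w1 w6 = s" "dist w2 w1 = r1" "dist w2 w3 = r2"
    "dist w5 w4 = r3" "dist w5 w6 = r4" by blast
  then have "dist w1 w3 \<in> {\<bar>r1 - r2\<bar>..r1 + r2}"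
    using dist_bounds[of w1 w3 w2] by simp
  then obtain f z where f: "\<And>x y. dist (f x) (f y) = dist x y" and z: "z \<in> Z" "f w1 = 0"
    "f w3 = of_real (B z)" "f w4 = D z" "f w6 = E z \<or> f w6 = cnj (E z)"
    using cover[OF w(2-5)] by metis
  have "dist (f w2) 0 = r1" "dist (f w2) (of_real (B z)) = r2" "dist (f w5) (D z) = r3"
    "dist (f w5) (f w6) = r4" "x = dist (f w2) (f w5)"
    using w f by (simp_all flip: z(2-4))
  then show "x \<in> ?R" using z(1,5) by blast
next
  fix x assume "x \<in> ?R"
  then obtain P Q z F where *: "x = dist P Q" "z \<in> Z" "F = E z \<or> F = cnj (E z)"
    "dist P 0 = r1" "dist P (of_real (B z)) = r2" "dist Q (D z) = r3" "dist Q F = r4" by blast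
  have "cmod F = s" "dist (of_real (B z)) F = r"
    using *(3) sides(3,4)[OF *(2)] dist_cnj_cnj[of "of_real (B z)" "E z"] by auto
  then have "dist 0 (D z) = p \<and> dist (of_real (B z)) (D z) = q \<and> dist (of_real (B z)) F = r \<and>
      dist 0 F = s \<and> dist P 0 = r1 \<and> dist P (of_real (B z)) = r2 \<and> dist Q (D z) = r3 \<and> dist Q F = r4"
    using * sides(1,2)[OF *(2)] by simp
  then show "x \<in> ?L" using *(1) by blast
qed

text \<open>Take a maximum point \<open>m\<close>: between any point and \<open>m\<close>,
  quasiconcavity keeps the function at least as large as at that point.\<close>

lemma quasiconcave_imp_unimodal:
  fixes f :: "real \<Rightarrow> real"
  assumes "a \<le> b" "continuous_on {a..b} f"
    and q: "\<And>x y z. a \<le> x \<Longrightarrow> x \<le> y \<Longrightarrow> y \<le> z \<Longrightarrow> z \<le> b \<Longrightarrow> min (f x) (f z) \<le> f y"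
  shows "\<exists>m\<in>{a..b}. mono_on {a..m} f \<and> antimono_on {m..b} f"
proof -
  obtain m where m: "m \<in> {a..b}" "\<And>x. x \<in> {a..b} \<Longrightarrow> f x \<le> f m"
    using continuous_attains_sup[of "{a..b}" f] assms(1,2) by auto
  have "mono_on {a..m} f"
  proof (rule monotone_onI)
    fix x y assume "x \<in> {a..m}" "y \<in> {a..m}" "x \<le> y"
    then show "f x \<le> f y" using q[of x y m] m(1) m(2)[of x] by auto
  qed
  moreover have "antimono_on {m..b} f"
  proof (rule monotone_onI)
    fix x y assume "x \<in> {m..b}" "y \<in> {m..b}" "x \<le> y"
    then show "f x \<ge> f y" using q[of m x y] m(1) m(2)[of y] by auto
  qed
  ultimately show ?thesis using m(1) by blast
qed

text \<open>A triangle with base from 0 to \<open>x\<close> on the real axis and sides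
  \<open>p\<close> at 0 and \<open>q\<close> at \<open>x\<close> has its apex above the point
  \<open>foot p q x\<close>; this is the law of cosines.\<close>

definition foot :: "real \<Rightarrow> real \<Rightarrow> real \<Rightarrow> real" where
  "foot p q x = (x\<^sup>2 + p\<^sup>2 - q\<^sup>2) / (2 * x)"

definition height :: "real \<Rightarrow> real \<Rightarrow> real \<Rightarrow> real" where
  "height p q x = sqrt (p\<^sup>2 - (foot p q x)\<^sup>2)"

lemma heron: "x \<noteq> 0 \<Longrightarrow> 4 * x\<^sup>2 * (p\<^sup>2 - (foot p q x)\<^sup>2) = ((p + q)\<^sup>2 - x\<^sup>2) * (x\<^sup>2 - (p - q)\<^sup>2)"
  by (simp add: foot_def field_simps power2_eq_square)

lemma height_square:
  assumes "0 < x" "x \<in> {\<bar>p - q\<bar>..p + q}"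
  shows "(height p q x)\<^sup>2 = p\<^sup>2 - (foot p q x)\<^sup>2" "0 \<le> height p q x"
proof -
  have "0 \<le> ((p + q)\<^sup>2 - x\<^sup>2) * (x\<^sup>2 - (p - q)\<^sup>2)"
    using assms by (intro mult_nonneg_nonneg) (simp_all add: power_mono flip: abs_le_square_iff)
  then have "0 \<le> (4 * x\<^sup>2) * (p\<^sup>2 - (foot p q x)\<^sup>2)"
    using heron[of x p q] assms by simp
  moreover have "0 < 4 * x\<^sup>2" using assms by simp
  ultimately have "0 \<le> p\<^sup>2 - (foot p q x)\<^sup>2" using zero_le_mult_iff not_less by blast
  then show "(height p q x)\<^sup>2 = p\<^sup>2 - (foot p q x)\<^sup>2" "0 \<le> height p q x"
    by (simp_all add: height_def)
qed

lemma height_degenerate: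
  assumes "0 < x" "x \<in> {\<bar>p - q\<bar>, p + q}"
  shows "height p q x = 0"
proof -
  have x2: "x\<^sup>2 = (p - q)\<^sup>2 \<or> x\<^sup>2 = (p + q)\<^sup>2"
    using assms(2) by (metis insertE power2_abs singletonD)
  have "4 * x\<^sup>2 * (p\<^sup>2 - (foot p q x)\<^sup>2) = 0"
    using heron[of x p q] assms(1) x2 by auto
  then show ?thesis using assms by (simp add: height_def)
qed

lemma triangle_apex:
  assumes "0 < x" "0 \<le> p" "0 \<le> q" "x \<in> {\<bar>p - q\<bar>..p + q}"
  shows "cmod (Complex (foot p q x) (height p q x)) = p"
    and "dist (of_real x) (Complex (foot p q x) (height p q x)) = q"
    and "cmod (Complex (foot p q x) (- height p q x)) = p"
    and "dist (of_real x) (Complex (foot p q x) (- height p q x)) = q"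
proof -
  note h = height_square(1)[OF assms(1,4)]
  have "(cmod (Complex (foot p q x) (height p q x)))\<^sup>2 = p\<^sup>2"
    by (simp add: cmod_power2 h)
  then show p: "cmod (Complex (foot p q x) (height p q x)) = p"
    using assms by (simp add: power2_eq_iff_nonneg)
  have "(dist (of_real x) (Complex (foot p q x) (height p q x)))\<^sup>2 = x\<^sup>2 - 2 * x * foot p q x + p\<^sup>2"
    unfolding dist_norm cmod_power2 using h by (simp add: power2_eq_square algebra_simps)
  also have "\<dots> = q\<^sup>2"
    using assms by (simp add: foot_def field_simps power2_eq_square)
  finally show q: "dist (of_real x) (Complex (foot p q x) (height p q x)) = q"
    using assms by (simp add: power2_eq_iff_nonneg)
  have c: "Complex (foot p q x) (- height p q x) = cnj (Complex (foot p q x) (height p q x))"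
    by (simp add: complex_eq_iff)
  show "cmod (Complex (foot p q x) (- height p q x)) = p"
    unfolding c using p by simp
  show "dist (of_real x) (Complex (foot p q x) (- height p q x)) = q"
    unfolding c using q dist_cnj_cnj[of "of_real x" "Complex (foot p q x) (height p q x)"] by simp
qed

lemma triangle_apex_unique:
  assumes "0 < x" "cmod v = p" "dist (of_real x) v = q"
  shows "Re v = foot p q x" "\<bar>Im v\<bar> = height p q x"
proof -
  have "q\<^sup>2 = x\<^sup>2 - 2 * x * Re v + p\<^sup>2"
    unfolding assms(2,3)[symmetric] dist_norm cmod_power2 by (simp add: power2_eq_square algebra_simps)
  then show Re: "Re v = foot p q x"
    using assms(1) by (simp add: foot_def field_simps power2_eq_square)
  have "(Im v)\<^sup>2 = p\<^sup>2 - (foot p q x)\<^sup>2"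
    using cmod_power2[of v] assms(2) Re by simp
  then show "\<bar>Im v\<bar> = height p q x"
    unfolding height_def by (simp flip: real_sqrt_abs)
qed

lemma foot_height_continuous:
  assumes "0 \<notin> S"
  shows "continuous_on S (foot p q)" "continuous_on S (height p q)"
proof -
  show "continuous_on S (foot p q)"
    unfolding foot_def using assms by (auto intro!: continuous_intros)
  then show "continuous_on S (height p q)"
    unfolding height_def by (intro continuous_intros)
qed

text \<open>Rotating the two triangles about their common side \<open>0 V\<close>, in any dimension, keeps the
  distance of their apexes between its values at the two planar positions.\<close>

lemma apex_dist_bounds:
  fixes V W W' :: "'a::real_inner"
  assumes x: "0 < x" "norm V = x"
    and W: "norm W = p" "dist V W = q" and W': "norm W' = s" "dist V W' = r"
  shows "(foot p q x - foot s r x)\<^sup>2 + (height p q x - height s r x)\<^sup>2 \<le> (dist W W')\<^sup>2"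
    and "(dist W W')\<^sup>2 \<le> (foot p q x - foot s r x)\<^sup>2 + (height p q x + height s r x)\<^sup>2"
proof -
  \<comment> \<open>With \<open>f\<close> the foot of \<open>U\<close>, \<open>n U f\<close> is the
    part of \<open>U\<close> orthogonal to the base, and its norm is the height. By Pythagoras only
    the distance between these orthogonal parts depends on the rotation.\<close>
  define n where "n U f = U - (f / x) *\<^sub>R V" for U f
  have VV: "V \<bullet> V = x\<^sup>2" using x by (simp add: dot_square_norm)
  have foot: "V \<bullet> U = x * foot a b x" if "norm U = a" "dist V U = b" for U a b
  proof -
    have "b\<^sup>2 = x\<^sup>2 - 2 * (V \<bullet> U) + a\<^sup>2"
      unfolding that[symmetric] dist_norm power2_norm_eq_inner using VV
      by (simp add: inner_diff_left inner_diff_right inner_commute)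
    then show ?thesis using x(1) by (simp add: foot_def)
  qed
  have n: "V \<bullet> n U (foot a b x) = 0" "norm (n U (foot a b x)) = height a b x"
    if "norm U = a" "dist V U = b" for U a b
  proof -
    show 0: "V \<bullet> n U (foot a b x) = 0"
      using foot[OF that] VV x(1) by (simp add: n_def inner_diff_right power2_eq_square)
    have "(norm (n U (foot a b x)))\<^sup>2 = U \<bullet> n U (foot a b x)"
      using 0 unfolding power2_norm_eq_inner by (simp add: n_def inner_diff_left)
    also have "\<dots> = a\<^sup>2 - (foot a b x)\<^sup>2"
      using foot[OF that] x(1) that(1)
      by (simp add: n_def inner_diff_right inner_commute dot_square_norm power2_eq_square)
    finally show "norm (n U (foot a b x)) = height a b x"
      by (simp add: height_def real_sqrt_unique)
  qed
  let ?n = "n W (foot p q x)" and ?n' = "n W' (foot s r x)"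
  have "W - W' = ((foot p q x - foot s r x) / x) *\<^sub>R V + (?n - ?n')"
    by (simp add: n_def diff_divide_distrib scaleR_diff_left)
  moreover have "(norm (c *\<^sub>R V + (?n - ?n')))\<^sup>2 = (c * x)\<^sup>2 + (norm (?n - ?n'))\<^sup>2" for c
    unfolding power2_norm_eq_inner using n(1)[OF W] n(1)[OF W'] VV
    by (simp add: inner_add_left inner_add_right inner_diff_left inner_diff_right inner_commute
        power2_eq_square algebra_simps)
  ultimately have eq: "(dist W W')\<^sup>2 = (foot p q x - foot s r x)\<^sup>2 + (norm (?n - ?n'))\<^sup>2"
    using x(1) by (simp add: dist_norm)
  have "\<bar>height p q x - height s r x\<bar> \<le> norm (?n - ?n')"
    using norm_triangle_ineq3[of ?n ?n'] n(2)[OF W] n(2)[OF W'] by simp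
  then show "(foot p q x - foot s r x)\<^sup>2 + (height p q x - height s r x)\<^sup>2 \<le> (dist W W')\<^sup>2"
    unfolding eq by (simp flip: abs_le_square_iff)
  have "norm (?n - ?n') \<le> height p q x + height s r x"
    using norm_triangle_ineq4[of ?n ?n'] n(2)[OF W] n(2)[OF W'] by simp
  then show "(dist W W')\<^sup>2 \<le> (foot p q x - foot s r x)\<^sup>2 + (height p q x + height s r x)\<^sup>2"
    unfolding eq by (simp add: power_mono)
qed

text \<open>Hence the squared diagonals of the linkages with given sides, in any dimension, form a convex
  set.\<close>

lemma convex_combination_of_configurations:
  fixes a b :: "'a::real_normed_vector" and a' b' :: "'b::real_normed_vector"
  assumes "0 \<le> t" "t \<le> 1"
  shows "(dist (sqrt (1 - t) *\<^sub>R a, sqrt t *\<^sub>R a') (sqrt (1 - t) *\<^sub>R b, sqrt t *\<^sub>R b'))\<^sup>2 =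
    (1 - t) * (dist a b)\<^sup>2 + t * (dist a' b')\<^sup>2"
proof -
  have *: "(dist (c *\<^sub>R x) (c *\<^sub>R y))\<^sup>2 = c\<^sup>2 * (dist x y)\<^sup>2" for c and x y :: "'c::real_normed_vector"
    by (simp add: dist_norm power_mult_distrib flip: scaleR_diff_right)
  show ?thesis using assms by (simp add: dist_Pair_Pair *)
qed

text \<open>The configurations over \<open>x1\<close> and \<open>x2\<close> are mixed into one in
  \<open>complex \<times> complex\<close> with the same sides and with base length \<open>x\<close>.
  Its squared apex distance is an average of the two given ones, and by
  \<open>apex_dist_bounds\<close> it lies between the squared planar extremes over
  \<open>x\<close>.\<close>

lemma apex_dist_quasi:
  assumes "0 < x1" "x1 \<le> x" "x \<le> x2"
    and V: "cmod V1 = p" "dist (of_real x1) V1 = q" "cmod V2 = p" "dist (of_real x2) V2 = q"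
    and W: "cmod W1 = s" "dist (of_real x1) W1 = r" "cmod W2 = s" "dist (of_real x2) W2 = r"
  shows "min (dist V1 W1) (dist V2 W2) \<le>
      sqrt ((foot p q x - foot s r x)\<^sup>2 + (height p q x + height s r x)\<^sup>2)"
    and "sqrt ((foot p q x - foot s r x)\<^sup>2 + (height p q x - height s r x)\<^sup>2) \<le>
      max (dist V1 W1) (dist V2 W2)"
proof -
  \<comment> \<open>The weight interpolates squared base lengths, since it is squared distances that
    average under mixing.\<close>
  define t where "t = (if x1 = x2 then 0 else (x\<^sup>2 - x1\<^sup>2) / (x2\<^sup>2 - x1\<^sup>2))"
  have x: "0 \<le> t" "t \<le> 1" "(1 - t) * x1\<^sup>2 + t * x2\<^sup>2 = x\<^sup>2"
  proof -
    have le: "x1\<^sup>2 \<le> x\<^sup>2" "x\<^sup>2 \<le> x2\<^sup>2"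
      using assms(1-3) by (simp_all add: power_mono)
    have lt: "x1\<^sup>2 < x2\<^sup>2" if "x1 \<noteq> x2"
      using assms(1-3) that by (simp add: power_strict_mono)
    show "0 \<le> t" "t \<le> 1" using le lt by (auto simp: t_def)
    show "(1 - t) * x1\<^sup>2 + t * x2\<^sup>2 = x\<^sup>2"
    proof (cases "x1 = x2")
      case False
      then have "t * (x2\<^sup>2 - x1\<^sup>2) = x\<^sup>2 - x1\<^sup>2" using lt by (simp add: t_def)
      then show ?thesis by (simp add: algebra_simps)
    qed (use assms in \<open>auto simp: t_def\<close>)
  qed
  define mix where "mix a b = (sqrt (1 - t) *\<^sub>R a, sqrt t *\<^sub>R b)" for a b :: complex
  have mix: "(dist (mix a b) (mix a' b'))\<^sup>2 = (1 - t) * (dist a a')\<^sup>2 + t * (dist b b')\<^sup>2" for a b a' b'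
    using convex_combination_of_configurations[OF x(1,2), of a b a' b'] by (simp only: mix_def)
  have mix_same: "dist (mix a b) (mix a' b') = d" if "dist a a' = d" "dist b b' = d" for a b a' b' d
  proof -
    have "(dist (mix a b) (mix a' b'))\<^sup>2 = d\<^sup>2"
      unfolding mix that by (simp add: algebra_simps)
    moreover have "0 \<le> d" using that(1) zero_le_dist[of a a'] by simp
    ultimately show ?thesis by (simp add: power2_eq_iff_nonneg)
  qed
  have mix0: "mix 0 0 = 0" by (simp add: mix_def zero_prod_def)
  have norm_mix: "norm (mix a b) = dist (mix 0 0) (mix a b)" for a b
    by (simp add: mix0)
  have nx: "norm (mix (of_real x1) (of_real x2)) = x"
  proof -
    have "(norm (mix (of_real x1) (of_real x2)))\<^sup>2 = x\<^sup>2"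
      unfolding norm_mix mix using x(3) by simp
    then show ?thesis using assms(1-3) by (simp add: power2_eq_iff_nonneg)
  qed
  have nV: "norm (mix V1 V2) = p" "dist (mix (of_real x1) (of_real x2)) (mix V1 V2) = q"
    unfolding norm_mix using V by (simp_all add: mix_same)
  have nW: "norm (mix W1 W2) = s" "dist (mix (of_real x1) (of_real x2)) (mix W1 W2) = r"
    unfolding norm_mix using W by (simp_all add: mix_same)
  have "0 < x" using assms by simp
  note bounds = apex_dist_bounds[OF this nx nV nW]
  show "min (dist V1 W1) (dist V2 W2) \<le>
      sqrt ((foot p q x - foot s r x)\<^sup>2 + (height p q x + height s r x)\<^sup>2)"
  proof (rule real_le_rsqrt)
    let ?m = "min (dist V1 W1) (dist V2 W2)"
    have "?m\<^sup>2 = (1 - t) * ?m\<^sup>2 + t * ?m\<^sup>2" by (simp add: algebra_simps)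
    also have "\<dots> \<le> (1 - t) * (dist V1 W1)\<^sup>2 + t * (dist V2 W2)\<^sup>2"
      using x(1,2) by (intro add_mono mult_left_mono power_mono) auto
    finally show "?m\<^sup>2 \<le> (foot p q x - foot s r x)\<^sup>2 + (height p q x + height s r x)\<^sup>2"
      using bounds(2) unfolding mix by simp
  qed
  show "sqrt ((foot p q x - foot s r x)\<^sup>2 + (height p q x - height s r x)\<^sup>2) \<le>
      max (dist V1 W1) (dist V2 W2)"
  proof (rule real_le_lsqrt)
    let ?m = "max (dist V1 W1) (dist V2 W2)"
    have "(1 - t) * (dist V1 W1)\<^sup>2 + t * (dist V2 W2)\<^sup>2 \<le> (1 - t) * ?m\<^sup>2 + t * ?m\<^sup>2"
      using x(1,2) by (intro add_mono mult_left_mono power_mono) auto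
    also have "\<dots> = ?m\<^sup>2" by (simp add: algebra_simps)
    finally show "(foot p q x - foot s r x)\<^sup>2 + (height p q x - height s r x)\<^sup>2 \<le> ?m\<^sup>2"
      using bounds(1) unfolding mix by simp
    show "0 \<le> ?m" by (simp add: le_max_iff_disj)
  qed
qed

section \<open>Normal position and the cases of coinciding or distinct \<open>v1\<close>,
  \<open>v3\<close>\<close>

lemma rotate_to_real: "\<exists>u. cmod u = 1 \<and> u * w = of_real (cmod w)"
proof (cases "w = 0")
  case False
  have "cmod (cnj w / of_real (cmod w)) = 1"
    using False by (simp add: norm_divide)
  moreover have "cnj w / of_real (cmod w) * w = of_real (cmod w)"
    using False by (simp add: complex_norm_square[symmetric] power2_eq_square mult.commute)
  ultimately show ?thesis by blast
qed (auto intro: exI[of _ 1])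

lemma exists_isometry_onto_real_axis:
  fixes w w' v :: complex
  shows "\<exists>f. (\<forall>x y. dist (f x) (f y) = dist x y) \<and> f w = 0 \<and> f w' = complex_of_real (dist w w') \<and>
    0 \<le> Im (f v)"
proof -
  obtain u where u: "cmod u = 1" "u * (w' - w) = of_real (cmod (w' - w))"
    using rotate_to_real by blast
  define f where "f x = u * (x - w)" for x
  have f: "dist (f x) (f y) = dist x y" for x y
  proof -
    have "f x - f y = u * (x - y)" by (simp add: f_def algebra_simps)
    then show ?thesis by (simp add: dist_norm norm_mult u(1))
  qed
  have f': "f w = 0" "f w' = of_real (dist w w')"
    using u(2) by (simp_all add: f_def dist_norm norm_minus_commute)
  show ?thesis
  proof (cases "0 \<le> Im (f v)")
    case True
    then show ?thesis using f f' by blast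
  next
    case False
    then show ?thesis using f f' by (intro exI[of _ "\<lambda>x. cnj (f x)"]) auto
  qed
qed

text \<open>The hypothesis \<open>pos\<close> keeps \<open>d(v1, v3)\<close> positive, so this
  length determines \<open>v4\<close> and, up to reflection, \<open>v6\<close>. Its range is cut out
  by the triangles over \<open>v1 v3\<close> with apexes \<open>v4\<close>, \<open>v6\<close>,
  \<open>v2\<close>, one of which degenerates at each end: for \<open>v2\<close> the two sides
  merge, for \<open>v4\<close> or \<open>v6\<close> the arcs meet.\<close>

lemma card_components_generic:
  assumes nonneg: "0 \<le> p" "0 \<le> q" "0 \<le> r" "0 \<le> s" "0 \<le> r1" "0 \<le> r2" "0 \<le> r3" "0 \<le> r4"
    and pos: "0 < max \<bar>p - q\<bar> (max \<bar>s - r\<bar> \<bar>r1 - r2\<bar>)"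
  defines "C \<equiv> {dist w2 w5 | w1 w2 w3 w4 w5 w6 :: complex. dist w1 w4 = p \<and> dist w3 w4 = q \<and>
      dist w3 w6 = r \<and> dist w1 w6 = s \<and> dist w2 w1 = r1 \<and> dist w2 w3 = r2 \<and>
      dist w5 w4 = r3 \<and> dist w5 w6 = r4}"
  shows "finite (components C) \<and> card (components C) \<le> 4"
proof -
  define a where "a = max \<bar>p - q\<bar> (max \<bar>s - r\<bar> \<bar>r1 - r2\<bar>)"
  define b where "b = min (p + q) (min (s + r) (r1 + r2))"
  define D where "D x = Complex (foot p q x) (height p q x)" for x
  define E where "E x = Complex (foot s r x) (- height s r x)" for x
  have ab: "0 < x" "x \<in> {\<bar>p - q\<bar>..p + q}" "x \<in> {\<bar>s - r\<bar>..s + r}" "x \<in> {\<bar>r1 - r2\<bar>..r1 + r2}"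
    if "x \<in> {a..b}" for x
    using that pos by (auto simp: a_def b_def)
  have D: "cmod (D x) = p" "dist (of_real x) (D x) = q" if "x \<in> {a..b}" for x
    unfolding D_def using triangle_apex(1,2) ab[OF that] nonneg by blast+
  have E: "cmod (E x) = s" "dist (of_real x) (E x) = r" if "x \<in> {a..b}" for x
    unfolding E_def using triangle_apex(3,4) ab[OF that] nonneg by blast+
  have E': "cmod (cnj (E x)) = s" "dist (of_real x) (cnj (E x)) = r" if "x \<in> {a..b}" for x
    using E[OF that] dist_cnj_cnj[of "of_real x" "E x"] by simp_all
  have dist_D_E: "dist (D x) (E x) =
      sqrt ((foot p q x - foot s r x)\<^sup>2 + (height p q x + height s r x)\<^sup>2)"
    "dist (D x) (cnj (E x)) = sqrt ((foot p q x - foot s r x)\<^sup>2 + (height p q x - height s r x)\<^sup>2)" for x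
    by (simp_all add: D_def E_def dist_norm cmod_def)
  have C_eq: "C = {dist P Q | P Q z F. z \<in> {a..b} \<and> (F = E z \<or> F = cnj (E z)) \<and>
      dist P 0 = r1 \<and> dist P (of_real z) = r2 \<and> dist Q (D z) = r3 \<and> dist Q F = r4}"
    unfolding C_def
  proof (rule linkage_values_eq)
    fix w1 w3 w4 w6 :: complex
    assume w: "dist w1 w4 = p" "dist w3 w4 = q" "dist w3 w6 = r" "dist w1 w6 = s"
      "dist w1 w3 \<in> {\<bar>r1 - r2\<bar>..r1 + r2}"
    obtain f where f: "\<And>x y. dist (f x) (f y) = dist x y" "f w1 = 0"
      "f w3 = of_real (dist w1 w3)" "0 \<le> Im (f w4)"
      using exists_isometry_onto_real_axis[of w1 w3 w4] by blast
    define x where "x = dist w1 w3"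
    have x: "x \<in> {a..b}"
      using w(5) dist_bounds[of w1 w3 w4] dist_bounds[of w1 w3 w6] w(1-4)
      unfolding x_def a_def b_def by (simp add: dist_commute)
    have "0 < x" using ab(1)[OF x] .
    have n: "cmod (f w4) = p" "dist (of_real x) (f w4) = q" "cmod (f w6) = s" "dist (of_real x) (f w6) = r"
      using f(1)[of w1 w4] f(1)[of w3 w4] f(1)[of w1 w6] f(1)[of w3 w6] f(2,3) w by (simp_all add: x_def)
    have "f w4 = D x"
      using triangle_apex_unique[OF \<open>0 < x\<close> n(1,2)] f(4) by (simp add: D_def complex_eq_iff)
    moreover have "f w6 = E x \<or> f w6 = cnj (E x)"
      using triangle_apex_unique[OF \<open>0 < x\<close> n(3,4)] by (auto simp: E_def complex_eq_iff abs_if split: if_splits)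
    ultimately show "\<exists>f z. (\<forall>x y. dist (f x) (f y) = dist x y) \<and> z \<in> {a..b} \<and> f w1 = 0 \<and>
        f w3 = complex_of_real z \<and> f w4 = D z \<and> (f w6 = E z \<or> f w6 = cnj (E z))"
      using x f(1-3) unfolding x_def by blast
  qed (use D E in auto)
  show ?thesis
  proof (cases "a \<le> b")
    case False
    then have "C = {}" unfolding C_eq by auto
    then show ?thesis by simp
  next
    case True
    have "0 \<notin> {a..b}" using ab(1) by blast
    note fh = foot_height_continuous[OF this]
    have cont: "continuous_on {a..b} D" "continuous_on {a..b} E"
      unfolding D_def E_def by (intro continuous_intros fh)+
    obtain mT where mT: "mT \<in> {a..b}" "mono_on {a..mT} (\<lambda>z. dist (D z) (E z))"
      "antimono_on {mT..b} (\<lambda>z. dist (D z) (E z))"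
    proof -
      have "\<exists>m\<in>{a..b}. mono_on {a..m} (\<lambda>z. dist (D z) (E z)) \<and> antimono_on {m..b} (\<lambda>z. dist (D z) (E z))"
      proof (rule quasiconcave_imp_unimodal[OF True])
        show "continuous_on {a..b} (\<lambda>z. dist (D z) (E z))"
          using cont by (intro continuous_intros)
        fix x1 x x2 assume *: "a \<le> x1" "x1 \<le> x" "x \<le> x2" "x2 \<le> b"
        then have "x1 \<in> {a..b}" "x2 \<in> {a..b}" by auto
        then show "min (dist (D x1) (E x1)) (dist (D x2) (E x2)) \<le> dist (D x) (E x)"
          unfolding dist_D_E(1)[of x]
          by (intro apex_dist_quasi(1)[OF _ *(2,3)]) (use ab D E in auto)
      qed
      then show ?thesis using that by blast
    qed
    obtain mF where mF: "mF \<in> {a..b}" "antimono_on {a..mF} (\<lambda>z. dist (D z) (cnj (E z)))"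
      "mono_on {mF..b} (\<lambda>z. dist (D z) (cnj (E z)))"
    proof -
      have "\<exists>m\<in>{a..b}. mono_on {a..m} (\<lambda>z. - dist (D z) (cnj (E z))) \<and>
          antimono_on {m..b} (\<lambda>z. - dist (D z) (cnj (E z)))"
      proof (rule quasiconcave_imp_unimodal[OF True])
        show "continuous_on {a..b} (\<lambda>z. - dist (D z) (cnj (E z)))"
          using cont by (intro continuous_intros)
        fix x1 x x2 assume *: "a \<le> x1" "x1 \<le> x" "x \<le> x2" "x2 \<le> b"
        then have "x1 \<in> {a..b}" "x2 \<in> {a..b}" by auto
        then have "dist (D x) (cnj (E x)) \<le> max (dist (D x1) (cnj (E x1))) (dist (D x2) (cnj (E x2)))"
          unfolding dist_D_E(2)[of x]
          by (intro apex_dist_quasi(2)[OF _ *(2,3)]) (use ab D E' in auto)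
        then show "min (- dist (D x1) (cnj (E x1))) (- dist (D x2) (cnj (E x2))) \<le> - dist (D x) (cnj (E x))"
          by auto
      qed
      then show ?thesis using that by (force simp: monotone_on_def)
    qed
    show ?thesis unfolding C_eq
    proof (rule card_components_linkage[where m = "\<lambda>u. if u then mT else mF"])
      show "0 \<le> Im (D z)" "Im (E z) \<le> 0" if "z \<in> {a..b}" for z
        using height_square(2)[OF ab(1,2)[OF that]] height_square(2)[OF ab(1,3)[OF that]]
        by (simp_all add: D_def E_def)
      show "\<bar>z\<bar> \<in> {\<bar>r1 - r2\<bar>..r1 + r2}" if "z \<in> {a..b}" for z
        using ab[OF that] by simp
      show "\<bar>e\<bar> \<in> {\<bar>r1 - r2\<bar>, r1 + r2} \<or> Im (D e) * Im (E e) = 0" if "e \<in> {a, b}" for e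
      proof -
        have "e \<in> {a..b}" using that True by auto
        then have e: "0 < e" using ab by blast
        have "e \<in> {\<bar>p - q\<bar>, p + q} \<or> e \<in> {\<bar>s - r\<bar>, s + r} \<or> e \<in> {\<bar>r1 - r2\<bar>, r1 + r2}"
        proof -
          have "a \<in> {\<bar>p - q\<bar>, \<bar>s - r\<bar>, \<bar>r1 - r2\<bar>}" "b \<in> {p + q, s + r, r1 + r2}"
            unfolding a_def b_def max_def min_def by simp_all
          then show ?thesis using that by blast
        qed
        then consider "height p q e = 0" | "height s r e = 0" | "e \<in> {\<bar>r1 - r2\<bar>, r1 + r2}"
          using height_degenerate[OF e, of p q] height_degenerate[OF e, of s r] by argo
        then show ?thesis
        proof cases
          case 3
          moreover have "\<bar>e\<bar> = e" using e by simp
          ultimately show ?thesis by simp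
        qed (simp_all add: D_def E_def)
      qed
    qed (use nonneg cont mT mF in \<open>simp_all add: continuous_on_id\<close>)
  qed
qed

text \<open>Here \<open>v1\<close> and \<open>v3\<close> may coincide, and then the linkage folds freely about them. The parameter is
  \<open>d(v1, v3)\<close> where this is positive; its negative values describe this folding.\<close>

lemma card_components_kite:
  assumes pos: "0 < p" "0 < s" and nonneg: "0 \<le> r1" "0 \<le> r3" "0 \<le> r4"
  defines "C \<equiv> {dist w2 w5 | w1 w2 w3 w4 w5 w6 :: complex. dist w1 w4 = p \<and> dist w3 w4 = p \<and>
      dist w3 w6 = s \<and> dist w1 w6 = s \<and> dist w2 w1 = r1 \<and> dist w2 w3 = r1 \<and>
      dist w5 w4 = r3 \<and> dist w5 w6 = r4}"
  shows "finite (components C) \<and> card (components C) \<le> 4"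
proof -
  define b where "b = min (2 * p) (min (2 * s) (2 * r1))"
  define B where "B z = max z 0" for z :: real
  \<comment> \<open>\<open>X z\<close> is the abscissa of \<open>v6\<close>. For
    \<open>z \<ge> 0\<close> it is the midpoint of the base. For \<open>z \<le> 0\<close>, where
    \<open>v1 = v3 = 0\<close> and \<open>v4\<close> is at height \<open>p\<close> on the imaginary
    axis, it is \<open>- s * z\<close>: together with its mirror image, \<open>v6\<close> sweeps the
    right half of its circle. At \<open>z = 0\<close> the two motions agree.\<close>
  define X where "X z = B z / 2 - s * min z 0" for z
  define h where "h z = sqrt (p\<^sup>2 - (B z / 2)\<^sup>2)" for z
  define k where "k z = sqrt (s\<^sup>2 - (X z)\<^sup>2)" for z
  define D where "D z = Complex (B z / 2) (h z)" for z
  define E where "E z = Complex (X z) (- k z)" for z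
  have b: "0 \<le> b" using assms by (simp add: b_def)
  have Bz: "0 \<le> B z" "B z \<le> b" if "z \<in> {-1..b}" for z
    using that b by (auto simp: B_def)
  have X: "0 \<le> X z" "X z \<le> s" if "z \<in> {-1..b}" for z
  proof -
    have "s * (- z) \<le> s * 1" using that pos by (intro mult_left_mono) auto
    moreover have "b \<le> 2 * s" by (simp add: b_def)
    ultimately show "0 \<le> X z" "X z \<le> s"
      using that pos by (cases "z \<le> 0"; simp add: X_def B_def mult_nonneg_nonpos)+
  qed
  have h2: "(h z)\<^sup>2 = p\<^sup>2 - (B z / 2)\<^sup>2" and k2: "(k z)\<^sup>2 = s\<^sup>2 - (X z)\<^sup>2"
    and hk: "0 \<le> h z" "0 \<le> k z" if "z \<in> {-1..b}" for z
  proof -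
    have "0 \<le> p\<^sup>2 - (B z / 2)\<^sup>2"
      using Bz[OF that] power_mono[of "B z / 2" p 2] by (simp add: b_def)
    moreover have "0 \<le> s\<^sup>2 - (X z)\<^sup>2"
      using X[OF that] by (simp add: power_mono)
    ultimately show "(h z)\<^sup>2 = p\<^sup>2 - (B z / 2)\<^sup>2" "(k z)\<^sup>2 = s\<^sup>2 - (X z)\<^sup>2" "0 \<le> h z" "0 \<le> k z"
      by (simp_all add: h_def k_def)
  qed
  \<comment> \<open>Either the base has length 0 or \<open>v6\<close> is over its midpoint; in both
    cases \<open>v6\<close> is equally far from \<open>v1\<close> and \<open>v3\<close>.\<close>
  have BX: "B z * (B z - 2 * X z) = 0" for z
    by (auto simp: B_def X_def max_def min_def)
  have sides: "cmod (D z) = p" "dist (of_real (B z)) (D z) = p" "dist (of_real (B z)) (E z) = s" "cmod (E z) = s"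
    if "z \<in> {-1..b}" for z
  proof -
    have "(cmod (D z))\<^sup>2 = p\<^sup>2" "(dist (of_real (B z)) (D z))\<^sup>2 = p\<^sup>2" "(cmod (E z))\<^sup>2 = s\<^sup>2"
      unfolding dist_norm cmod_power2 using h2[OF that] k2[OF that] by (simp_all add: D_def E_def)
    moreover have "(dist (of_real (B z)) (E z))\<^sup>2 = s\<^sup>2"
      unfolding dist_norm cmod_power2 using k2[OF that] BX[of z]
      by (simp add: E_def power2_eq_square algebra_simps)
    ultimately show "cmod (D z) = p" "dist (of_real (B z)) (D z) = p"
      "dist (of_real (B z)) (E z) = s" "cmod (E z) = s"
      using pos by (simp_all add: power2_eq_iff_nonneg)
  qed
  have left: "dist (D z) (E z) = sqrt (p\<^sup>2 + s\<^sup>2 + 2 * p * sqrt (s\<^sup>2 - (s * z)\<^sup>2))"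
    "dist (D z) (cnj (E z)) = sqrt (p\<^sup>2 + s\<^sup>2 - 2 * p * sqrt (s\<^sup>2 - (s * z)\<^sup>2))"
    if "z \<in> {-1..0}" for z
  proof -
    have z: "z \<in> {-1..b}" using that b by auto
    have [simp]: "B z = 0" "X z = - (s * z)" using that by (auto simp: B_def X_def)
    have hp: "h z = p" using pos by (simp add: h_def)
    have kz: "k z = sqrt (s\<^sup>2 - (s * z)\<^sup>2)" by (simp add: k_def)
    have "(k z)\<^sup>2 = s\<^sup>2 - (s * z)\<^sup>2" using k2[OF z] by simp
    then have "(s * z)\<^sup>2 + (p + k z)\<^sup>2 = p\<^sup>2 + s\<^sup>2 + 2 * p * k z"
      "(s * z)\<^sup>2 + (p - k z)\<^sup>2 = p\<^sup>2 + s\<^sup>2 - 2 * p * k z"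
      by (simp_all add: power2_sum power2_diff)
    then show "dist (D z) (E z) = sqrt (p\<^sup>2 + s\<^sup>2 + 2 * p * sqrt (s\<^sup>2 - (s * z)\<^sup>2))"
      "dist (D z) (cnj (E z)) = sqrt (p\<^sup>2 + s\<^sup>2 - 2 * p * sqrt (s\<^sup>2 - (s * z)\<^sup>2))"
      unfolding kz[symmetric] by (simp_all add: dist_norm cmod_def D_def E_def hp)
  qed
  have right: "dist (D z) (E z) = h z + k z" "dist (D z) (cnj (E z)) = \<bar>h z - k z\<bar>"
    if "z \<in> {0..b}" for z
  proof -
    have "B z / 2 - X z = 0" using that by (simp add: B_def X_def)
    moreover have "z \<in> {-1..b}" using that by auto
    ultimately show "dist (D z) (E z) = h z + k z" "dist (D z) (cnj (E z)) = \<bar>h z - k z\<bar>"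
      using hk[of z] by (simp_all add: dist_norm cmod_def D_def E_def)
  qed
  have left_mono: "sqrt (s\<^sup>2 - (s * z)\<^sup>2) \<le> sqrt (s\<^sup>2 - (s * z')\<^sup>2)" if "z \<le> z'" "z' \<le> 0" for z z'
  proof -
    have "(- z')\<^sup>2 \<le> (- z)\<^sup>2" using that by (intro power_mono) auto
    then have "s\<^sup>2 * z'\<^sup>2 \<le> s\<^sup>2 * z\<^sup>2" by (intro mult_left_mono) simp_all
    then show ?thesis by (simp only: power_mult_distrib real_sqrt_le_iff diff_left_mono)
  qed
  have right_mono: "h z' \<le> h z" "k z' \<le> k z" if "0 \<le> z" "z \<le> z'" for z z'
  proof -
    have "(z / 2)\<^sup>2 \<le> (z' / 2)\<^sup>2" using that by (intro power_mono) auto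
    then show "h z' \<le> h z" "k z' \<le> k z"
      using that by (simp_all add: h_def k_def B_def X_def)
  qed
  \<comment> \<open>The product of \<open>h - k\<close> and \<open>h + k\<close> is the constant
    \<open>p\<^sup>2 - s\<^sup>2\<close>, while \<open>h + k\<close> decreases. So the absolute
    difference increases.\<close>
  have diff_mono: "\<bar>h z - k z\<bar> \<le> \<bar>h z' - k z'\<bar>" if z: "0 \<le> z" "z \<le> z'" "z' \<le> b" for z z'
  proof -
    have *: "\<bar>h y - k y\<bar> * (h y + k y) = \<bar>p\<^sup>2 - s\<^sup>2\<bar>" if y: "0 \<le> y" "y \<le> b" for y
    proof -
      have y': "y \<in> {-1..b}" using y by auto
      have "\<bar>h y - k y\<bar> * (h y + k y) = \<bar>(h y - k y) * (h y + k y)\<bar>"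
        using hk[OF y'] by (simp add: abs_mult)
      also have "(h y - k y) * (h y + k y) = (h y)\<^sup>2 - (k y)\<^sup>2"
        by (simp add: power2_eq_square algebra_simps)
      also have "\<dots> = p\<^sup>2 - s\<^sup>2"
        using h2[OF y'] k2[OF y'] y by (simp add: B_def X_def)
      finally show ?thesis .
    qed
    have zz: "z \<in> {-1..b}" "z' \<in> {-1..b}" using z by auto
    show ?thesis
    proof (cases "h z + k z = 0")
      case True
      then have "h z = 0" "k z = 0" using hk[OF zz(1)] by auto
      then show ?thesis by simp
    next
      case False
      then have "0 < h z + k z" using hk[OF zz(1)] by auto
      moreover have "\<bar>h z - k z\<bar> * (h z + k z) \<le> \<bar>h z' - k z'\<bar> * (h z + k z)"
      proof -
        have "\<bar>h z - k z\<bar> * (h z + k z) = \<bar>h z' - k z'\<bar> * (h z' + k z')"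
          using *[of z] *[of z'] z by simp
        also have "\<dots> \<le> \<bar>h z' - k z'\<bar> * (h z + k z)"
          using right_mono[OF z(1,2)] by (intro mult_left_mono) auto
        finally show ?thesis .
      qed
      ultimately show ?thesis by (simp only: mult_le_cancel_right_pos)
    qed
  qed
  have C_eq: "C = {dist P Q | P Q z F. z \<in> {-1..b} \<and> (F = E z \<or> F = cnj (E z)) \<and>
      dist P 0 = r1 \<and> dist P (of_real (B z)) = r1 \<and> dist Q (D z) = r3 \<and> dist Q F = r4}"
    unfolding C_def
  proof (rule linkage_values_eq)
    fix w1 w3 w4 w6 :: complex
    assume w: "dist w1 w4 = p" "dist w3 w4 = p" "dist w3 w6 = s" "dist w1 w6 = s"
      "dist w1 w3 \<in> {\<bar>r1 - r1\<bar>..r1 + r1}"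
    show "\<exists>f z. (\<forall>x y. dist (f x) (f y) = dist x y) \<and> z \<in> {-1..b} \<and> f w1 = 0 \<and>
        f w3 = complex_of_real (B z) \<and> f w4 = D z \<and> (f w6 = E z \<or> f w6 = cnj (E z))"
    proof (cases "w1 = w3")
      case False
      obtain f where f: "\<And>x y. dist (f x) (f y) = dist x y" "f w1 = 0"
        "f w3 = of_real (dist w1 w3)" "0 \<le> Im (f w4)"
        using exists_isometry_onto_real_axis[of w1 w3 w4] by blast
      define x where "x = dist w1 w3"
      have x: "0 < x" using False by (simp add: x_def)
      have xb: "x \<le> b"
        using w(5) dist_bounds[of w1 w3 w4] dist_bounds[of w1 w3 w6] w(1-4)
        unfolding x_def b_def by (simp add: dist_commute)
      have [simp]: "B x = x" "X x = x / 2" using x by (auto simp: B_def X_def)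
      have foot: "foot a a x = x / 2" for a
        using x by (simp add: foot_def power2_eq_square)
      have n: "cmod (f w4) = p" "dist (of_real x) (f w4) = p" "cmod (f w6) = s" "dist (of_real x) (f w6) = s"
        using f(1)[of w1 w4] f(1)[of w3 w4] f(1)[of w1 w6] f(1)[of w3 w6] f(2,3) w by (simp_all add: x_def)
      have "f w4 = D x"
        using triangle_apex_unique[OF x n(1,2)] f(4) by (simp add: D_def h_def height_def foot complex_eq_iff)
      moreover have "f w6 = E x \<or> f w6 = cnj (E x)"
        using triangle_apex_unique[OF x n(3,4)]
        by (auto simp: E_def k_def height_def foot complex_eq_iff abs_if split: if_splits)
      moreover have "f w3 = complex_of_real (B x)" using f(3) by (simp add: x_def[symmetric])
      moreover have "x \<in> {-1..b}" using x xb by simp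
      ultimately show ?thesis using f(1,2) by blast
    next
      case True
      obtain f where f: "\<And>x y. dist (f x) (f y) = dist x y" "f w1 = 0"
        "f w4 = of_real (dist w1 w4)" "0 \<le> Im (f w6)"
        using exists_isometry_onto_real_axis[of w1 w4 w6] by blast
      \<comment> \<open>\<open>f\<close> puts \<open>v4\<close> on the positive real axis and
        \<open>v6\<close> in the upper half plane. Reflection in the diagonal moves
        \<open>v4\<close> to the imaginary axis and \<open>v6\<close> to the right half plane, as
        the parametrisation requires.\<close>
      define g where "g x = \<i> * cnj (f x)" for x
      have g: "dist (g x) (g y) = dist x y" for x y
      proof -
        have "dist (g x) (g y) = dist (cnj (f x)) (cnj (f y))"
          by (simp add: g_def dist_norm norm_mult flip: right_diff_distrib)
        then show ?thesis using f(1) by simp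
      qed
      define z where "z = - (Re (g w6) / s)"
      have ng: "cmod (g w6) = s"
        using g[of w1 w6] f(2) w(4) by (simp add: g_def)
      then have Re: "0 \<le> Re (g w6)" "Re (g w6) \<le> s"
        using f(4) complex_Re_le_cmod[of "g w6"] by (simp_all add: g_def)
      then have z: "-1 \<le> z" "z \<le> 0" using pos by (simp_all add: z_def)
      have [simp]: "B z = 0" "X z = Re (g w6)"
        using z pos by (auto simp: B_def X_def z_def min_def)
      have "g w4 = D z"
        using f(3) w(1) pos by (simp add: g_def D_def h_def complex_eq_iff)
      moreover have "(Im (g w6))\<^sup>2 = s\<^sup>2 - (Re (g w6))\<^sup>2"
        using cmod_power2[of "g w6"] ng by simp
      then have "\<bar>Im (g w6)\<bar> = k z"
        unfolding k_def by (simp flip: real_sqrt_abs)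
      then have "g w6 = E z \<or> g w6 = cnj (E z)"
        by (auto simp: E_def complex_eq_iff abs_if split: if_splits)
      moreover have "g w1 = 0" "g w3 = complex_of_real (B z)"
        using f(2) True by (simp_all add: g_def)
      moreover have "z \<in> {-1..b}" using z b by simp
      ultimately show ?thesis using g by blast
    qed
  qed (use sides in auto)
  show ?thesis unfolding C_eq
  \<comment> \<open>Both extrema are at \<open>z = 0\<close>: there \<open>v1 = v3\<close> and
    \<open>v4\<close>, \<open>v6\<close> are collinear with this point, so their distance is
    \<open>p + s\<close> or the absolute value of \<open>p - s\<close>.\<close>
  proof (rule card_components_linkage[where m = "\<lambda>_. 0"])
    show cont_B: "continuous_on {-1..b} B" unfolding B_def by (intro continuous_intros)
    show "continuous_on {-1..b} D"
      unfolding D_def h_def by (intro continuous_intros cont_B) auto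
    have "continuous_on {-1..b} X" unfolding X_def by (intro continuous_intros cont_B) auto
    then show "continuous_on {-1..b} E"
      unfolding E_def k_def by (intro continuous_intros)
    show "0 \<le> Im (D z)" "Im (E z) \<le> 0" if "z \<in> {-1..b}" for z
      using hk[OF that] by (simp_all add: D_def E_def)
    show "\<bar>B z\<bar> \<in> {\<bar>r1 - r1\<bar>..r1 + r1}" if "z \<in> {-1..b}" for z
      using Bz[OF that] by (simp add: b_def)
    show "mono_on {-1..0} (\<lambda>z. dist (D z) (E z))"
      using left_mono pos by (intro monotone_onI) (simp add: left mult_left_mono)
    show "antimono_on {-1..0} (\<lambda>z. dist (D z) (cnj (E z)))"
      using left_mono pos by (intro monotone_onI) (simp add: left mult_left_mono)
    show "antimono_on {0..b} (\<lambda>z. dist (D z) (E z))"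
      using right_mono by (intro monotone_onI) (simp add: right add_mono)
    show "mono_on {0..b} (\<lambda>z. dist (D z) (cnj (E z)))"
      using diff_mono by (intro monotone_onI) (simp add: right)
    show "\<bar>B e\<bar> \<in> {\<bar>r1 - r1\<bar>, r1 + r1} \<or> Im (D e) * Im (E e) = 0" if e: "e \<in> {-1, b}" for e
    proof -
      have Bb: "B b = b" "X b = b / 2" using b by (simp_all add: B_def X_def)
      have "b = 2 * p \<or> b = 2 * s \<or> b = 2 * r1" by (simp add: b_def min_def)
      then consider "e = -1" | "e = b" "b = 2 * p" | "e = b" "b = 2 * s" | "e = b" "b = 2 * r1"
        using e by blast
      then show ?thesis
      proof cases
        case 1
        \<comment> \<open>At the end of the folding motion \<open>v6\<close> is on the real axis,
          where its two positions coincide.\<close>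
        then have "k e = 0" by (simp add: k_def X_def B_def)
        then show ?thesis by (simp add: E_def)
      next
        case 2
        then have "h e = 0" using Bb by (simp add: h_def)
        then show ?thesis by (simp add: D_def)
      next
        case 3
        then have "k e = 0" using Bb by (simp add: k_def)
        then show ?thesis by (simp add: E_def)
      next
        case 4
        then show ?thesis using Bb b by simp
      qed
    qed
  qed (use nonneg b in simp_all)
qed

text \<open>If one of the sides is 0, then \<open>v1\<close>, \<open>v3\<close> and one of
  \<open>v4\<close>, \<open>v6\<close> coincide, and the linkage is rigid up to isometry. A
  one-point parameter interval suffices, with both arcs equal.\<close>

lemma card_components_point:
  assumes "0 \<le> p" "0 \<le> s" "p * s = 0" and nonneg: "0 \<le> r1" "0 \<le> r3" "0 \<le> r4"
  defines "C \<equiv> {dist w2 w5 | w1 w2 w3 w4 w5 w6 :: complex. dist w1 w4 = p \<and> dist w3 w4 = p \<and>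
      dist w3 w6 = s \<and> dist w1 w6 = s \<and> dist w2 w1 = r1 \<and> dist w2 w3 = r1 \<and>
      dist w5 w4 = r3 \<and> dist w5 w6 = r4}"
  shows "finite (components C) \<and> card (components C) \<le> 4"
proof -
  have C_eq: "C = {dist P Q | P Q z F. z \<in> {0..0::real} \<and> (F = of_real s \<or> F = cnj (of_real s)) \<and>
      dist P 0 = r1 \<and> dist P (of_real 0) = r1 \<and> dist Q (of_real p) = r3 \<and> dist Q F = r4}"
    unfolding C_def
  proof (rule linkage_values_eq[where B = "\<lambda>_. 0" and D = "\<lambda>_. of_real p" and E = "\<lambda>_. of_real s"])
    fix w1 w3 w4 w6 :: complex
    assume w: "dist w1 w4 = p" "dist w3 w4 = p" "dist w3 w6 = s" "dist w1 w6 = s"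
    have "w1 = w3"
      using w assms(3) by (metis dist_eq_0_iff mult_eq_0_iff)
    \<comment> \<open>The vertex that may differ from \<open>v1\<close> is the one to be rotated
      onto the real axis.\<close>
    define v where "v = (if p = 0 then w6 else w4)"
    obtain f where f: "\<And>x y. dist (f x) (f y) = dist x y" "f w1 = 0" "f v = of_real (dist w1 v)" "0 \<le> Im (f v)"
      using exists_isometry_onto_real_axis[of w1 v v] by blast
    have "f w4 = of_real p \<and> f w6 = of_real s"
    proof (cases "p = 0")
      case True
      then have "w1 = w4" using w by simp
      then show ?thesis using f w True by (simp add: v_def)
    next
      case False
      then have "w1 = w6" using w assms(3) by simp
      then show ?thesis using f w False by (simp add: v_def)
    qed
    then show "\<exists>f z. (\<forall>x y. dist (f x) (f y) = dist x y) \<and> z \<in> {0..0::real} \<and> f w1 = 0 \<and>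
        f w3 = complex_of_real 0 \<and> f w4 = of_real p \<and> (f w6 = of_real s \<or> f w6 = cnj (of_real s))"
      using f(1,2) \<open>w1 = w3\<close> by (intro exI[of _ f] exI[of _ 0]) simp
  qed (use assms(1,2) in auto)
  show ?thesis unfolding C_eq
    by (rule card_components_linkage[where m = "\<lambda>_. 0" and B = "\<lambda>_. 0" and
        D = "\<lambda>_. of_real p" and E = "\<lambda>_. of_real s"])
      (use nonneg in \<open>simp_all add: monotone_on_def\<close>)
qed

text \<open>The length 0 is allowed for \<open>d(v1, v3)\<close> only if all three triangles over it
  are isosceles, which leaves the kite and its collapsed form as exceptions.\<close>

lemma card_components_K33:
  assumes nonneg: "0 \<le> p" "0 \<le> q" "0 \<le> r" "0 \<le> s" "0 \<le> r1" "0 \<le> r2" "0 \<le> r3" "0 \<le> r4"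
  defines "C \<equiv> {dist w2 w5 | w1 w2 w3 w4 w5 w6 :: complex. dist w1 w4 = p \<and> dist w3 w4 = q \<and>
      dist w3 w6 = r \<and> dist w1 w6 = s \<and> dist w2 w1 = r1 \<and> dist w2 w3 = r2 \<and>
      dist w5 w4 = r3 \<and> dist w5 w6 = r4}"
  shows "finite (components C) \<and> card (components C) \<le> 4"
proof (cases "0 < max \<bar>p - q\<bar> (max \<bar>s - r\<bar> \<bar>r1 - r2\<bar>)")
  case True
  then show ?thesis
    using card_components_generic[OF nonneg] unfolding C_def by simp
next
  case False
  then have eq: "q = p" "r = s" "r2 = r1" by auto
  show ?thesis
  proof (cases "p * s = 0")
    case True
    then show ?thesis
      using card_components_point[of p s r1 r3 r4] nonneg unfolding C_def eq by simp
  next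
    case False
    then have "0 < p" "0 < s" using nonneg by (simp_all add: order_less_le)
    then show ?thesis
      using card_components_kite[of p s r1 r3 r4] nonneg unfolding C_def eq by simp
  qed
qed

section \<open>Spans of open chains and quadrilaterals\<close>

text \<open>The edge vectors of an open chain range independently over circles, and the span is a
  continuous function of them.\<close>

lemma connected_path_span:
  shows "connected {dist w5 w6 | w1 w2 w3 w4 w5 w6 :: complex. dist w6 w1 = a \<and> dist w1 w2 = b \<and>
    dist w2 w3 = c \<and> dist w3 w4 = d \<and> dist w4 w5 = e}" (is "connected ?S")
proof -
  let ?T = "sphere (0::complex) a \<times> sphere (0::complex) b \<times> sphere (0::complex) c \<times> sphere (0::complex) d \<times> sphere (0::complex) e"
  let ?f = "\<lambda>(u1, u2, u3, u4, u5). norm (u1 + u2 + u3 + u4 + u5 :: complex)"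
  have "?S = ?f ` ?T"
  proof (intro subset_antisym subsetI)
    fix x assume "x \<in> ?S"
    then obtain w1 w2 w3 w4 w5 w6 :: complex where w: "x = dist w5 w6" "dist w6 w1 = a"
      "dist w1 w2 = b" "dist w2 w3 = c" "dist w3 w4 = d" "dist w4 w5 = e" by blast
    then have "x = ?f (w1 - w6, w2 - w1, w3 - w2, w4 - w3, w5 - w4)"
      "(w1 - w6, w2 - w1, w3 - w2, w4 - w3, w5 - w4) \<in> ?T"
      by (simp_all add: dist_norm norm_minus_commute)
    then show "x \<in> ?f ` ?T" by blast
  next
    fix x assume "x \<in> ?f ` ?T"
    then obtain u1 u2 u3 u4 u5 :: complex where u: "x = norm (u1 + u2 + u3 + u4 + u5)"
      "norm u1 = a" "norm u2 = b" "norm u3 = c" "norm u4 = d" "norm u5 = e" by auto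
    then have "x = dist (u1 + u2 + u3 + u4 + u5) 0 \<and> dist 0 u1 = a \<and> dist u1 (u1 + u2) = b \<and>
        dist (u1 + u2) (u1 + u2 + u3) = c \<and> dist (u1 + u2 + u3) (u1 + u2 + u3 + u4) = d \<and>
        dist (u1 + u2 + u3 + u4) (u1 + u2 + u3 + u4 + u5) = e"
      by (simp add: dist_norm)
    then show "x \<in> ?S" by blast
  qed
  moreover have "connected (?f ` ?T)"
    by (intro connected_continuous_image connected_Times connected_sphere)
      (auto simp: case_prod_beta intro!: continuous_intros)
  ultimately show ?thesis by simp
qed

lemma connected_three_bar_span:
  "connected {x. 0 \<le> x \<and> (\<exists>v w :: complex. dist 0 v = a \<and> dist v w = b \<and> dist w (of_real x) = c)}"
    (is "connected ?S")
proof -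
  let ?T = "sphere (0::complex) a \<times> sphere (0::complex) b \<times> sphere (0::complex) c"
  let ?f = "\<lambda>(u1, u2, u3). norm (u1 + u2 + u3 :: complex)"
  have "?S = ?f ` ?T"
  proof (intro subset_antisym subsetI)
    fix x assume "x \<in> ?S"
    then obtain v w :: complex where w: "0 \<le> x" "dist 0 v = a" "dist v w = b" "dist w (of_real x) = c"
      by blast
    then have "x = ?f (v, w - v, of_real x - w)" "(v, w - v, of_real x - w) \<in> ?T"
      by (simp_all add: dist_norm norm_minus_commute)
    then show "x \<in> ?f ` ?T" by blast
  next
    fix x assume "x \<in> ?f ` ?T"
    then obtain u1 u2 u3 :: complex where u: "x = norm (u1 + u2 + u3)"
      "norm u1 = a" "norm u2 = b" "norm u3 = c" by auto
    obtain k where k: "cmod k = 1" "k * (u1 + u2 + u3) = of_real x"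
      using rotate_to_real[of "u1 + u2 + u3"] u(1) by auto
    have "dist 0 (k * u1) = a" "dist (k * u1) (k * (u1 + u2)) = b"
      "dist (k * (u1 + u2)) (k * (u1 + u2 + u3)) = c"
      using u k(1) by (simp_all add: dist_norm norm_mult flip: right_diff_distrib)
    then show "x \<in> ?S" unfolding k(2) using u(1) by auto
  qed
  moreover have "connected (?f ` ?T)"
    by (intro connected_continuous_image connected_Times connected_sphere)
      (auto simp: case_prod_beta intro!: continuous_intros)
  ultimately show ?thesis by simp
qed

text \<open>The quadrilaterals \<open>v1 v2 v3 v4\<close> and \<open>v1 v6 v5 v4\<close> share only
  \<open>v1\<close> and \<open>v4\<close>, so each diagonal length allowed by both is attained. An
  intersection of two intervals is an interval.\<close>

lemma connected_two_quadrilaterals_span: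
  "connected {dist w1 w4 | w1 w2 w3 w4 w5 w6 :: complex. dist w5 w6 = g \<and> dist w6 w1 = a \<and>
    dist w1 w2 = b \<and> dist w2 w3 = c \<and> dist w3 w4 = d \<and> dist w4 w5 = e}" (is "connected ?S")
proof -
  define R where "R a b c =
    {x. 0 \<le> x \<and> (\<exists>v w :: complex. dist 0 v = a \<and> dist v w = b \<and> dist w (of_real x) = c)}" for a b c
  have "?S = R b c d \<inter> R a g e"
  proof (intro subset_antisym subsetI)
    fix x assume "x \<in> ?S"
    then obtain w1 w2 w3 w4 w5 w6 :: complex where w: "x = dist w1 w4" "dist w6 w1 = a"
      "dist w1 w2 = b" "dist w2 w3 = c" "dist w3 w4 = d" "dist w4 w5 = e" "dist w5 w6 = g" by blast
    obtain f where f: "\<And>x y. dist (f x) (f y) = dist x y" "f w1 = 0" "f w4 = complex_of_real (dist w1 w4)"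
      using exists_isometry_onto_real_axis[of w1 w4 w4] by blast
    have "dist 0 (f w2) = b" "dist (f w2) (f w3) = c" "dist (f w3) (of_real x) = d"
      "dist 0 (f w6) = a" "dist (f w6) (f w5) = g" "dist (f w5) (of_real x) = e"
      unfolding w(1) f(2,3)[symmetric] f(1) using w by (simp_all add: dist_commute)
    moreover have "0 \<le> x" using w(1) by simp
    ultimately show "x \<in> R b c d \<inter> R a g e" unfolding R_def by blast
  next
    fix x assume "x \<in> R b c d \<inter> R a g e"
    then obtain w2 w3 w6 w5 :: complex where "0 \<le> x" "dist 0 w2 = b" "dist w2 w3 = c"
      "dist w3 (of_real x) = d" "dist 0 w6 = a" "dist w6 w5 = g" "dist w5 (of_real x) = e"
      unfolding R_def by blast
    then have "x = dist 0 (complex_of_real x) \<and> dist w6 0 = a \<and> dist 0 w2 = b \<and> dist w2 w3 = c \<and>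
        dist w3 (of_real x) = d \<and> dist (of_real x) w5 = e \<and> dist w5 w6 = g"
      by (simp add: dist_commute)
    then show "x \<in> ?S" by blast
  qed
  moreover have "is_interval (R b c d \<inter> R a g e)"
    unfolding R_def
    by (intro is_interval_Int) (simp_all only: is_interval_connected_1 connected_three_bar_span)
  ultimately show ?thesis by (simp add: is_interval_connected_1)
qed

text \<open>On a circle about 0 the distance to a point of the real axis is monotone in the real
  part, so the admissible real parts form an interval, and the half circle is a graph over
  it.\<close>

lemma connected_half_circle_arc:
  "connected {w :: complex. cmod w = \<rho> \<and> dist w (of_real \<delta>) \<in> {lo..hi} \<and> 0 \<le> Im w}" (is "connected ?S")
proof -
  let ?g = "\<lambda>t. sqrt (\<rho>\<^sup>2 + \<delta>\<^sup>2 - 2 * \<delta> * t)"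
  let ?T = "{t. - \<rho> \<le> t \<and> t \<le> \<rho> \<and> lo \<le> ?g t \<and> ?g t \<le> hi}"
  let ?f = "\<lambda>t. Complex t (sqrt (\<rho>\<^sup>2 - t\<^sup>2))"
  have dist: "dist w (of_real \<delta>) = ?g (Re w)" if "cmod w = \<rho>" for w
  proof -
    have "(dist w (of_real \<delta>))\<^sup>2 = \<rho>\<^sup>2 + \<delta>\<^sup>2 - 2 * \<delta> * Re w"
      unfolding that[symmetric] dist_norm cmod_power2 by (simp add: power2_eq_square algebra_simps)
    then show ?thesis by (metis real_sqrt_unique zero_le_dist)
  qed
  have norm_f: "cmod (?f t) = \<rho> \<and> 0 \<le> Im (?f t)" if "- \<rho> \<le> t" "t \<le> \<rho>" for t
  proof -
    have "t\<^sup>2 \<le> \<rho>\<^sup>2" using that by (intro abs_le_square_iff[THEN iffD1]) auto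
    then show ?thesis using that by (simp add: cmod_def)
  qed
  have "?S = ?f ` ?T"
  proof (intro subset_antisym subsetI)
    fix w assume w: "w \<in> ?S"
    then have "Re w \<in> ?T"
      using dist[of w] abs_Re_le_cmod[of w] by auto
    moreover have "(Im w)\<^sup>2 = \<rho>\<^sup>2 - (Re w)\<^sup>2"
      using w cmod_power2[of w] by simp
    then have "w = ?f (Re w)"
      using w by (simp add: complex_eq_iff real_sqrt_unique)
    ultimately show "w \<in> ?f ` ?T" by blast
  next
    fix w assume "w \<in> ?f ` ?T"
    then obtain t where "w = ?f t" "t \<in> ?T" by blast
    then show "w \<in> ?S" using norm_f[of t] dist[of "?f t"] by simp
  qed
  moreover have "is_interval ?T"
    unfolding is_interval_1
  proof (intro ballI allI impI)
    fix t1 t2 t assume t: "t1 \<in> ?T" "t2 \<in> ?T" "t1 \<le> t \<and> t \<le> t2"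
    have "?g t1 \<le> ?g t \<and> ?g t \<le> ?g t2 \<or> ?g t2 \<le> ?g t \<and> ?g t \<le> ?g t1"
      using t(3) by (cases "0 \<le> \<delta>") (auto simp: mult_left_mono mult_left_mono_neg)
    then show "t \<in> ?T" using t by (simp only: mem_Collect_eq) linarith
  qed
  then have "connected ?T" by (simp only: is_interval_connected_1)
  then have "connected (?f ` ?T)"
    by (rule connected_continuous_image[rotated]) (intro continuous_intros)
  ultimately show ?thesis by simp
qed

lemma exists_apex:
  fixes A B :: complex
  assumes "0 \<le> r" "0 \<le> r'" "dist A B \<in> {\<bar>r - r'\<bar>..r + r'}"
  shows "\<exists>P. dist P A = r \<and> dist P B = r'"
  using apexes_nonempty[OF assms, of True] by (auto simp: apexes_def)

text \<open>With \<open>v1 = 0\<close> and \<open>v4 = p\<close> fixed, \<open>v3\<close> and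
  \<open>v6\<close> move independently, each on an arc of a half circle or its mirror image. A
  common reflection puts \<open>v3\<close> above the axis. The two sets come from \<open>v6\<close>
  on the same or on the opposite side.\<close>

lemma two_quadrilaterals_apex_distances:
  assumes nonneg: "0 \<le> a" "0 \<le> b" "0 \<le> c" "0 \<le> d" "0 \<le> e" "0 \<le> g" "0 \<le> p"
  shows "\<exists>S T. connected S \<and> connected T \<and>
    {dist w3 w6 | w1 w2 w3 w4 w5 w6 :: complex. dist w1 w4 = p \<and> dist w5 w6 = g \<and>
      dist w6 w1 = a \<and> dist w1 w2 = b \<and> dist w2 w3 = c \<and> dist w3 w4 = d \<and> dist w4 w5 = e} = S \<union> T"
    (is "\<exists>S T. _ \<and> _ \<and> ?W = _")
proof -
  define U where "U = (\<lambda>w. w + of_real p) `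
    {w :: complex. cmod w = d \<and> dist w (of_real (- p)) \<in> {\<bar>b - c\<bar>..b + c} \<and> 0 \<le> Im w}"
  define L where "L = {w :: complex. cmod w = a \<and> dist w (of_real p) \<in> {\<bar>e - g\<bar>..e + g} \<and> 0 \<le> Im w}"
  have U_iff: "w \<in> U \<longleftrightarrow> dist w (of_real p) = d \<and> cmod w \<in> {\<bar>b - c\<bar>..b + c} \<and> 0 \<le> Im w" for w
  proof -
    have "w \<in> U \<longleftrightarrow> w - of_real p \<in>
        {w. cmod w = d \<and> dist w (of_real (- p)) \<in> {\<bar>b - c\<bar>..b + c} \<and> 0 \<le> Im w}"
      unfolding U_def by (force simp: image_iff)
    then show ?thesis by (simp add: dist_norm)
  qed
  have conn: "connected U" "connected L"
    unfolding U_def L_def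
    by (intro connected_continuous_image continuous_intros connected_half_circle_arc)
      (rule connected_half_circle_arc)
  let ?S = "(\<lambda>(v, w). dist v w) ` (U \<times> L)" and ?T = "(\<lambda>(v, w). dist v (cnj w)) ` (U \<times> L)"
  have "?W = ?S \<union> ?T"
  proof (intro subset_antisym subsetI)
    fix x assume "x \<in> ?W"
    then obtain w1 w2 w3 w4 w5 w6 :: complex where w: "x = dist w3 w6" "dist w6 w1 = a"
      "dist w1 w2 = b" "dist w2 w3 = c" "dist w3 w4 = d" "dist w4 w5 = e" "dist w5 w6 = g" "dist w1 w4 = p"
      by blast
    obtain f where f: "\<And>x y. dist (f x) (f y) = dist x y" "f w1 = 0"
      "f w4 = of_real (dist w1 w4)" "0 \<le> Im (f w3)"
      using exists_isometry_onto_real_axis[of w1 w4 w3] by blast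
    have n: "cmod (f x) = dist w1 x" "dist (f x) (of_real p) = dist x w4" for x
      using f(1)[of w1 x] f(1)[of x w4] f(2,3) w(8) by simp_all
    have "f w3 \<in> U"
      unfolding U_iff n using f(4) w dist_bounds[of w1 w3 w2] by (simp add: dist_commute)
    moreover have "dist w4 w6 \<in> {\<bar>e - g\<bar>..e + g}"
      using w dist_bounds[of w4 w6 w5] by (simp add: dist_commute)
    then have "f w6 \<in> L \<or> cnj (f w6) \<in> L"
      using n[of w6] w(2) dist_cnj_cnj[of "f w6" "of_real p"]
      by (cases "0 \<le> Im (f w6)") (auto simp: L_def dist_commute)
    moreover have "x = dist (f w3) (f w6)" using w(1) f(1) by simp
    ultimately show "x \<in> ?S \<union> ?T" by (force simp: image_iff)
  next
    fix x assume "x \<in> ?S \<union> ?T"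
    then obtain w3 w6 where w: "w3 \<in> U" "x = dist w3 w6" "w6 \<in> L \<or> cnj w6 \<in> L" by auto
    then have 3: "dist w3 (of_real p) = d" "dist 0 w3 \<in> {\<bar>b - c\<bar>..b + c}" by (simp_all add: U_iff)
    have 6: "dist w6 0 = a" "dist (of_real p) w6 \<in> {\<bar>e - g\<bar>..e + g}"
      using w(3) dist_cnj_cnj[of w6 "of_real p"] by (auto simp: L_def dist_commute)
    obtain w2 where "dist w2 0 = b" "dist w2 w3 = c"
      using exists_apex[OF nonneg(2,3) 3(2)] by blast
    moreover obtain w5 where "dist w5 (of_real p) = e" "dist w5 w6 = g"
      using exists_apex[OF nonneg(5,6) 6(2)] by blast
    ultimately have "x = dist w3 w6 \<and> dist w6 0 = a \<and> dist 0 w2 = b \<and> dist w2 w3 = c \<and>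
        dist w3 (of_real p) = d \<and> dist (of_real p) w5 = e \<and> dist w5 w6 = g \<and> dist 0 (complex_of_real p) = p"
      using w(2) 3(1) 6(1) nonneg(7) by (simp add: dist_commute)
    then show "x \<in> ?W" by blast
  qed
  moreover have "connected ?S" "connected ?T"
    using conn by (auto simp: case_prod_beta intro!: connected_continuous_image connected_Times continuous_intros)
  ultimately show ?thesis by blast
qed

section \<open>The subgraphs of $K_{3,3}$\<close>

text \<open>Passing to \<open>complex\<close> lets multiplication and conjugation serve as rotations
  and reflections.\<close>

lemma realizable_iff_complex:
  "realizable G l \<longleftrightarrow> (\<exists>p :: 'a \<Rightarrow> complex. \<forall>u\<in>verts G. \<forall>v\<in>verts G.
    {u, v} \<in> edges G \<longrightarrow> dist (p u) (p v) = l {u, v})"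
proof
  define c :: "real ^ 2 \<Rightarrow> complex" where "c x = Complex (x $ 1) (x $ 2)" for x
  have c: "dist (c x) (c y) = dist x y" for x y
    by (simp add: c_def dist_norm cmod_def norm_vec_def L2_set_def sum_2)
  assume "realizable G l"
  then obtain p where "is_realization G l p" unfolding realizable_def by blast
  then show "\<exists>p :: 'a \<Rightarrow> complex. \<forall>u\<in>verts G. \<forall>v\<in>verts G.
      {u, v} \<in> edges G \<longrightarrow> dist (p u) (p v) = l {u, v}"
    unfolding is_realization_def using c by (intro exI[of _ "\<lambda>v. c (p v)"]) simp
next
  define c :: "complex \<Rightarrow> real ^ 2" where "c z = vector [Re z, Im z]" for z
  have c: "dist (c x) (c y) = dist x y" for x y
    by (simp add: c_def dist_norm cmod_def norm_vec_def L2_set_def sum_2)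
  assume "\<exists>p :: 'a \<Rightarrow> complex. \<forall>u\<in>verts G. \<forall>v\<in>verts G.
      {u, v} \<in> edges G \<longrightarrow> dist (p u) (p v) = l {u, v}"
  then obtain p :: "'a \<Rightarrow> complex" where "\<forall>u\<in>verts G. \<forall>v\<in>verts G.
      {u, v} \<in> edges G \<longrightarrow> dist (p u) (p v) = l {u, v}" by blast
  then show "realizable G l"
    unfolding realizable_def is_realization_def using c by (intro exI[of _ "\<lambda>v. c (p v)"]) simp
qed

text \<open>An edge matches two ordered pairs of vertices, but by symmetry of the distance they
  impose one equation. Repeated use turns realizability into a conjunction over the edges.\<close>

lemma ball_edges_insert:
  fixes p :: "'a \<Rightarrow> 'b::metric_space"
  assumes "a \<in> V" "b \<in> V"
  shows "(\<forall>u\<in>V. \<forall>v\<in>V. {u, v} \<in> insert {a, b} E \<longrightarrow> dist (p u) (p v) = l {u, v}) \<longleftrightarrow>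
    dist (p a) (p b) = l {a, b} \<and> (\<forall>u\<in>V. \<forall>v\<in>V. {u, v} \<in> E \<longrightarrow> dist (p u) (p v) = l {u, v})"
proof -
  have "dist (p u) (p v) = l {u, v}" if "{u, v} = {a, b}" "dist (p a) (p b) = l {a, b}" for u v
  proof -
    have "(u = a \<and> v = b) \<or> (u = b \<and> v = a)" using that(1) by (simp add: doubleton_eq_iff)
    then have "dist (p u) (p v) = dist (p a) (p b)" by (auto simp: dist_commute)
    then show ?thesis using that by simp
  qed
  then show ?thesis using assms by blast
qed

lemma ex_vertex_map:
  "(\<exists>p :: vertex \<Rightarrow> 'a. P (p v1) (p v2) (p v3) (p v4) (p v5) (p v6)) \<longleftrightarrow>
    (\<exists>w1 w2 w3 w4 w5 w6. P w1 w2 w3 w4 w5 w6)"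
proof
  assume "\<exists>w1 w2 w3 w4 w5 w6. P w1 w2 w3 w4 w5 w6"
  then obtain w1 w2 w3 w4 w5 w6 where "P w1 w2 w3 w4 w5 w6" by blast
  then show "\<exists>p :: vertex \<Rightarrow> 'a. P (p v1) (p v2) (p v3) (p v4) (p v5) (p v6)"
    by (intro exI[of _ "case_vertex w1 w2 w3 w4 w5 w6"]) simp
qed blast

lemma verts_simps: "verts K33 = {v1, v2, v3, v4, v5, v6}" "verts G3 = {v1, v2, v3, v4, v5, v6}"
  "verts G2 = {v1, v2, v3, v4, v5, v6}" "verts G1 = {v1, v2, v3, v4, v5, v6}"
  by (simp_all add: G1_def G2_def G3_def delete_edge_def K33_def)

text \<open>The edges are listed in the order of deletion, so each smaller edge set is a tail of
  this list.\<close>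

lemma edges_K33: "edges K33 = {{v2, v5}, {v3, v6}, {v1, v4}, {v5, v6}, {v6, v1}, {v1, v2}, {v2, v3}, {v3, v4}, {v4, v5}}"
  by (auto simp: K33_def)

lemma edges_G3: "edges G3 = {{v3, v6}, {v1, v4}, {v5, v6}, {v6, v1}, {v1, v2}, {v2, v3}, {v3, v4}, {v4, v5}}"
  by (simp add: G3_def delete_edge_def edges_K33 insert_Diff_if doubleton_eq_iff)

lemma edges_G2: "edges G2 = {{v1, v4}, {v5, v6}, {v6, v1}, {v1, v2}, {v2, v3}, {v3, v4}, {v4, v5}}"
  by (simp add: G2_def delete_edge_def edges_G3 insert_Diff_if doubleton_eq_iff)

lemma edges_G1: "edges G1 = {{v5, v6}, {v6, v1}, {v1, v2}, {v2, v3}, {v3, v4}, {v4, v5}}"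
  by (simp add: G1_def delete_edge_def edges_G2 insert_Diff_if doubleton_eq_iff)

lemma edges_G0: "edges G0 = {{v6, v1}, {v1, v2}, {v2, v3}, {v3, v4}, {v4, v5}}"
  by (simp add: G0_def delete_edge_def edges_G1 insert_Diff_if doubleton_eq_iff)

lemma realizable_G1: "realizable G1 l \<longleftrightarrow> (\<exists>w1 w2 w3 w4 w5 w6 :: complex.
    dist w5 w6 = l {v5, v6} \<and> dist w6 w1 = l {v6, v1} \<and> dist w1 w2 = l {v1, v2} \<and>
    dist w2 w3 = l {v2, v3} \<and> dist w3 w4 = l {v3, v4} \<and> dist w4 w5 = l {v4, v5})"
  unfolding realizable_iff_complex verts_simps edges_G1 ex_vertex_map[symmetric]
  by (subst ball_edges_insert, simp, simp)+ simp

lemma realizable_G2: "realizable G2 l \<longleftrightarrow> (\<exists>w1 w2 w3 w4 w5 w6 :: complex.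
    dist w1 w4 = l {v1, v4} \<and>
    dist w5 w6 = l {v5, v6} \<and> dist w6 w1 = l {v6, v1} \<and> dist w1 w2 = l {v1, v2} \<and>
    dist w2 w3 = l {v2, v3} \<and> dist w3 w4 = l {v3, v4} \<and> dist w4 w5 = l {v4, v5})"
  unfolding realizable_iff_complex verts_simps edges_G2 ex_vertex_map[symmetric]
  by (subst ball_edges_insert, simp, simp)+ simp

lemma realizable_G3: "realizable G3 l \<longleftrightarrow> (\<exists>w1 w2 w3 w4 w5 w6 :: complex.
    dist w3 w6 = l {v3, v6} \<and> dist w1 w4 = l {v1, v4} \<and>
    dist w5 w6 = l {v5, v6} \<and> dist w6 w1 = l {v6, v1} \<and> dist w1 w2 = l {v1, v2} \<and>
    dist w2 w3 = l {v2, v3} \<and> dist w3 w4 = l {v3, v4} \<and> dist w4 w5 = l {v4, v5})"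
  unfolding realizable_iff_complex verts_simps edges_G3 ex_vertex_map[symmetric]
  by (subst ball_edges_insert, simp, simp)+ simp

lemma realizable_K33: "realizable K33 l \<longleftrightarrow> (\<exists>w1 w2 w3 w4 w5 w6 :: complex.
    dist w2 w5 = l {v2, v5} \<and> dist w3 w6 = l {v3, v6} \<and> dist w1 w4 = l {v1, v4} \<and>
    dist w5 w6 = l {v5, v6} \<and> dist w6 w1 = l {v6, v1} \<and> dist w1 w2 = l {v1, v2} \<and>
    dist w2 w3 = l {v2, v3} \<and> dist w3 w4 = l {v3, v4} \<and> dist w4 w5 = l {v4, v5})"
  unfolding realizable_iff_complex verts_simps edges_K33 ex_vertex_map[symmetric]
  by (subst ball_edges_insert, simp, simp)+ simp

section \<open>Admissible lengths of an added edge as attained distances\<close>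

lemma nonneg_values_eq:
  fixes f :: "'a \<Rightarrow> 'b \<Rightarrow> 'c \<Rightarrow> 'd \<Rightarrow> 'e \<Rightarrow> 'f \<Rightarrow> real"
  assumes "\<And>w1 w2 w3 w4 w5 w6. 0 \<le> f w1 w2 w3 w4 w5 w6"
  shows "{x. 0 \<le> x \<and> (\<exists>w1 w2 w3 w4 w5 w6. f w1 w2 w3 w4 w5 w6 = x \<and> R w1 w2 w3 w4 w5 w6)} =
    {f w1 w2 w3 w4 w5 w6 | w1 w2 w3 w4 w5 w6. R w1 w2 w3 w4 w5 w6}"
  using assms by blast

lemmas update_simps = fun_upd_apply doubleton_eq_iff vertex.distinct simp_thms if_True if_False

lemma length_nonneg: "l \<in> length_functions G \<Longrightarrow> e \<in> edges G \<Longrightarrow> 0 \<le> l e"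
  unfolding length_functions_def by (auto dest: PiE_mem)

lemma G1_spans:
  assumes "l \<in> length_functions G0"
  shows "real_interval {f. 0 \<le> f \<and> realizable G1 (l({v5, v6} := f))}" (is "real_interval ?S")
proof -
  have nonneg: "0 \<le> l {v6, v1}" "0 \<le> l {v1, v2}" "0 \<le> l {v2, v3}" "0 \<le> l {v3, v4}" "0 \<le> l {v4, v5}"
    using length_nonneg[OF assms] by (simp_all add: edges_G0)
  have eq: "?S = {dist w5 w6 | w1 w2 w3 w4 w5 w6 :: complex. dist w6 w1 = l {v6, v1} \<and>
      dist w1 w2 = l {v1, v2} \<and> dist w2 w3 = l {v2, v3} \<and> dist w3 w4 = l {v3, v4} \<and>
      dist w4 w5 = l {v4, v5}}"
    unfolding realizable_G1 by (simp only: update_simps) (rule nonneg_values_eq, rule zero_le_dist)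
  have "connected ?S" unfolding eq by (rule connected_path_span)
  moreover have "?S \<noteq> {}"
  proof -
    \<comment> \<open>The open chain can always be laid out straight along the real axis, which
      shows that some length is admissible.\<close>
    define W :: "real \<Rightarrow> complex" where "W x = of_real x" for x
    have W: "dist (W x) (W (x + y)) = y" if "0 \<le> y" for x y
      using that by (simp add: W_def dist_norm)
    have "realizable G1 (l({v5, v6} := dist (W (0 + l {v6, v1} + l {v1, v2} + l {v2, v3} + l {v3, v4} + l {v4, v5})) (W 0)))"
      unfolding realizable_G1
      by (simp only: update_simps) (rule exI conjI refl W nonneg)+
    then show ?thesis using zero_le_dist by blast
  qed
  ultimately show ?thesis by (simp add: real_interval_def is_interval_connected_1)
qed

lemma G2_spans:
  assumes "realizable G1 l"
  shows "real_interval {\<alpha>. 0 \<le> \<alpha> \<and> realizable G2 (l({v1, v4} := \<alpha>))}" (is "real_interval ?S")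
proof -
  have eq: "?S = {dist w1 w4 | w1 w2 w3 w4 w5 w6 :: complex. dist w5 w6 = l {v5, v6} \<and>
      dist w6 w1 = l {v6, v1} \<and> dist w1 w2 = l {v1, v2} \<and> dist w2 w3 = l {v2, v3} \<and>
      dist w3 w4 = l {v3, v4} \<and> dist w4 w5 = l {v4, v5}}"
    unfolding realizable_G2 by (simp only: update_simps) (rule nonneg_values_eq, rule zero_le_dist)
  have "connected ?S" unfolding eq by (rule connected_two_quadrilaterals_span)
  moreover have "?S \<noteq> {}"
    using assms unfolding eq realizable_G1 by blast
  ultimately show ?thesis by (simp add: real_interval_def is_interval_connected_1)
qed

lemma G3_spans:
  assumes "l \<in> length_functions G2" "realizable G2 l"
  defines "B \<equiv> {\<beta>. 0 \<le> \<beta> \<and> realizable G3 (l({v3, v6} := \<beta>))}"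
  shows "real_interval B \<or> disjoint_union_of_intervals 2 B"
proof -
  have eq: "B = {dist w3 w6 | w1 w2 w3 w4 w5 w6 :: complex. dist w1 w4 = l {v1, v4} \<and>
      dist w5 w6 = l {v5, v6} \<and> dist w6 w1 = l {v6, v1} \<and> dist w1 w2 = l {v1, v2} \<and>
      dist w2 w3 = l {v2, v3} \<and> dist w3 w4 = l {v3, v4} \<and> dist w4 w5 = l {v4, v5}}"
    unfolding B_def realizable_G3
    by (simp only: update_simps) (rule nonneg_values_eq, rule zero_le_dist)
  have "B \<noteq> {}" using assms(2) unfolding eq realizable_G2 by blast
  moreover have "\<exists>S T. connected S \<and> connected T \<and> B = S \<union> T"
    unfolding eq
    by (rule two_quadrilaterals_apex_distances; rule length_nonneg[OF assms(1)]) (simp_all add: edges_G2)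
  ultimately show ?thesis using interval_or_two_intervals by blast
qed

lemma K33_spans:
  assumes "l \<in> length_functions G3" "realizable G3 l"
  defines "C \<equiv> {\<gamma>. 0 \<le> \<gamma> \<and> realizable K33 (l({v2, v5} := \<gamma>))}"
  shows "real_interval C \<or> (\<exists>k\<in>{2, 3, 4}. disjoint_union_of_intervals k C)"
proof (rule interval_or_few_intervals)
  have eq: "C = {dist w2 w5 | w1 w2 w3 w4 w5 w6 :: complex. dist w3 w6 = l {v3, v6} \<and>
      dist w1 w4 = l {v1, v4} \<and> dist w5 w6 = l {v5, v6} \<and> dist w6 w1 = l {v6, v1} \<and>
      dist w1 w2 = l {v1, v2} \<and> dist w2 w3 = l {v2, v3} \<and> dist w3 w4 = l {v3, v4} \<and>
      dist w4 w5 = l {v4, v5}}"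
    unfolding C_def realizable_K33
    by (simp only: update_simps) (rule nonneg_values_eq, rule zero_le_dist)
  show "C \<noteq> {}"
    using assms(2) unfolding eq realizable_G3 by blast
  \<comment> \<open>The edges are regrouped as the linkage \<open>v1 v4 v3 v6\<close> followed by
    the triangles on \<open>v2\<close> and \<open>v5\<close>.\<close>
  have eq': "C = {dist w2 w5 | w1 w2 w3 w4 w5 w6 :: complex. dist w1 w4 = l {v1, v4} \<and>
      dist w3 w4 = l {v3, v4} \<and> dist w3 w6 = l {v3, v6} \<and> dist w1 w6 = l {v6, v1} \<and>
      dist w2 w1 = l {v1, v2} \<and> dist w2 w3 = l {v2, v3} \<and> dist w5 w4 = l {v4, v5} \<and>
      dist w5 w6 = l {v5, v6}}"
    unfolding eq by (intro Collect_cong ex_cong1) (auto simp: dist_commute)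
  have "finite (components C) \<and> card (components C) \<le> 4"
    unfolding eq' by (rule card_components_K33; rule length_nonneg[OF assms(1)]) (simp_all add: edges_G3)
  then show "finite (components C)" "card (components C) \<le> 4" by auto
qed

theorem theorem2p5:
  fixes l0 :: "vertex set \<Rightarrow> real"
  assumes "l0 \<in> length_functions G0"
  shows "real_interval {f. 0 \<le> f \<and> realizable G1 (l0({v5, v6} := f))} \<and>
    (\<forall>l1 \<in> extensions G1 G0 l0. realizable G1 l1 \<longrightarrow>
      real_interval {\<alpha>. 0 \<le> \<alpha> \<and> realizable G2 (l1({v1, v4} := \<alpha>))} \<and>
      (\<forall>l2 \<in> extensions G2 G1 l1. realizable G2 l2 \<longrightarrow>
        (let B = {\<beta>. 0 \<le> \<beta> \<and> realizable G3 (l2({v3, v6} := \<beta>))}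
         in real_interval B \<or> disjoint_union_of_intervals 2 B) \<and>
        (\<forall>l3 \<in> extensions G3 G2 l2. realizable G3 l3 \<longrightarrow>
          (let C = {\<gamma>. 0 \<le> \<gamma> \<and> realizable K33 (l3({v2, v5} := \<gamma>))}
           in real_interval C \<or> (\<exists>k\<in>{2, 3, 4}. disjoint_union_of_intervals k C)))))"
  unfolding Let_def
proof (intro conjI ballI impI)
  show "real_interval {f. 0 \<le> f \<and> realizable G1 (l0({v5, v6} := f))}"
    using assms by (rule G1_spans)
next
  fix l1 assume "realizable G1 l1"
  then show "real_interval {\<alpha>. 0 \<le> \<alpha> \<and> realizable G2 (l1({v1, v4} := \<alpha>))}"
    by (rule G2_spans)
next
  fix l1 l2 assume "l2 \<in> extensions G2 G1 l1" "realizable G2 l2"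
  moreover from this have "l2 \<in> length_functions G2" by (simp only: extensions_def mem_Collect_eq)
  ultimately show "real_interval {\<beta>. 0 \<le> \<beta> \<and> realizable G3 (l2({v3, v6} := \<beta>))} \<or>
      disjoint_union_of_intervals 2 {\<beta>. 0 \<le> \<beta> \<and> realizable G3 (l2({v3, v6} := \<beta>))}"
    by (intro G3_spans)
next
  fix l2 l3 assume "l3 \<in> extensions G3 G2 l2" "realizable G3 l3"
  moreover from this have "l3 \<in> length_functions G3" by (simp only: extensions_def mem_Collect_eq)
  ultimately show "real_interval {\<gamma>. 0 \<le> \<gamma> \<and> realizable K33 (l3({v2, v5} := \<gamma>))} \<or>
      (\<exists>k\<in>{2, 3, 4}. disjoint_union_of_intervals k {\<gamma>. 0 \<le> \<gamma> \<and> realizable K33 (l3({v2, v5} := \<gamma>))})"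
    by (intro K33_spans)
qed

end
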